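(* Let $(\rho(\theta))_{\theta\in\mathbb{R}^L}$ be a second-order differentiable family of positive definite states on a finite-dimensional Hilbert space. For all $\theta\in\mathbb{R}^L$, the matrix-valued function $\alpha\mapsto\overline I_\alpha(\theta)$ (the Petz--Rényi information matrix) is monotone decreasing on $\alpha\in(0,\frac12]$ and monotone increasing on $\alpha\in[\frac12,\infty)$, with respect to the Loewner order.
   Context: A state is a positive semi-definite operator of unit trace. For positive definite states $\rho,\sigma$ and $\alpha\in(0,1)\cup(1,\infty)$, the Petz--Rényi relative entropy is $\overline D_\alpha(\rho\|\sigma):=\frac{1}{\alpha-1}\ln\mathrm{Tr}[\rho^\alpha\sigma^{1-\alpha}]$, and the Petz--Rényi information matrix is the $L\times L$ matrix with entries $[\overline I_\alpha(\theta)]_{i,j}:=\frac1\alpha\left.\frac{\partial^2}{\partial\varepsilon_i\partial\varepsilon_j}\overline D_\alpha(\rho(\theta)\|\rho(\theta+\varepsilon))\right|_{\varepsilon=0}$. At $\alpha=1$, $\overline I_1(\theta)$ is understood as the limit $\lim_{\alpha\to1}\overline I_\alpha(\theta)$, which is the Kubo--Mori information matrix with entries $\left.\frac{\partial^2}{\partial\varepsilon_i\partial\varepsilon_j}\mathrm{Tr}[\rho(\theta)(\ln\rho(\theta)-\ln\rho(\theta+\varepsilon))]\right|_{\varepsilon=0}$. Monotone decreasing/increasing is meant in the non-strict sense; the Loewner order is $A\le B$ iff $B-A$ is positive semi-definite. *)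

theory Defs
  imports "HOL-Analysis.Analysis"
begin

text \<open>
  Operators on an \<open>n\<close>-dimensional Hilbert space are complex matrices indexed by a
  finite type \<open>'n\<close>, i.e. written in a fixed orthonormal basis.
\<close>

definition adjoint_matrix :: "complex^'n^'n \<Rightarrow> complex^'n^'n" where
  "adjoint_matrix A = (\<chi> i j. cnj (A $ j $ i))"

definition hermitian_matrix :: "complex^'n^'n \<Rightarrow> bool" where
  "hermitian_matrix A \<longleftrightarrow> adjoint_matrix A = A"

definition unitary_matrix :: "complex^'n^'n \<Rightarrow> bool" where
  "unitary_matrix U \<longleftrightarrow> U ** adjoint_matrix U = mat 1 \<and> adjoint_matrix U ** U = mat 1"

definition quadratic_form :: "complex^'n^'n \<Rightarrow> complex^'n \<Rightarrow> complex" where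
  "quadratic_form A x = (\<Sum>i\<in>UNIV. cnj (x $ i) * (A *v x) $ i)"

text \<open>The quadratic form of a Hermitian matrix is real, so \<open>Re\<close> loses nothing below.\<close>

definition pos_semidef :: "complex^'n^'n \<Rightarrow> bool" where
  "pos_semidef A \<longleftrightarrow> hermitian_matrix A \<and> (\<forall>x. 0 \<le> Re (quadratic_form A x))"

definition pos_def :: "complex^'n^'n \<Rightarrow> bool" where
  "pos_def A \<longleftrightarrow> hermitian_matrix A \<and> (\<forall>x. x \<noteq> 0 \<longrightarrow> 0 < Re (quadratic_form A x))"

definition state :: "complex^'n^'n \<Rightarrow> bool" where
  "state A \<longleftrightarrow> pos_semidef A \<and> trace A = 1"

definition real_diag :: "('n \<Rightarrow> real) \<Rightarrow> complex^'n^'n" where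
  "real_diag d = (\<chi> i j. if i = j then complex_of_real (d i) else 0)"

text \<open>
  Functional calculus: for a Hermitian matrix, the result does not depend on the spectral
  decomposition that is used, so the description is proper. It is unspecified for
  non-Hermitian matrices.
\<close>

definition matrix_fun :: "(real \<Rightarrow> real) \<Rightarrow> complex^'n^'n \<Rightarrow> complex^'n^'n" where
  "matrix_fun f A = (THE B. \<exists>U d. unitary_matrix U \<and>
      A = U ** real_diag d ** adjoint_matrix U \<and>
      B = U ** real_diag (f \<circ> d) ** adjoint_matrix U)"

definition matrix_powr :: "complex^'n^'n \<Rightarrow> real \<Rightarrow> complex^'n^'n" where
  "matrix_powr A a = matrix_fun (\<lambda>x. x powr a) A"

text \<open>
  For positive definite arguments the trace is a positive real number. The value is
  meaningful for \<open>\<alpha> \<in> (0,1) \<union> (1,\<infinity>)\<close> only.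
\<close>

definition petz_renyi_divergence ::
  "real \<Rightarrow> complex^'n^'n \<Rightarrow> complex^'n^'n \<Rightarrow> real" where
  "petz_renyi_divergence \<alpha> \<rho> \<sigma> =
     1 / (\<alpha> - 1) * ln (Re (trace (matrix_powr \<rho> \<alpha> ** matrix_powr \<sigma> (1 - \<alpha>))))"

definition partial_deriv :: "'l \<Rightarrow> (real^'l \<Rightarrow> real) \<Rightarrow> real^'l \<Rightarrow> real" where
  "partial_deriv i f x = deriv (\<lambda>t. f (x + t *\<^sub>R axis i 1)) 0"

definition petz_renyi_hessian ::
  "(real^'l \<Rightarrow> complex^'n^'n) \<Rightarrow> real^'l \<Rightarrow> real \<Rightarrow> real^'l^'l" where
  "petz_renyi_hessian \<rho> \<theta> \<alpha> = (\<chi> i j. 1 / \<alpha> *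
     partial_deriv i (partial_deriv j
       (\<lambda>\<epsilon>. petz_renyi_divergence \<alpha> (\<rho> \<theta>) (\<rho> (\<theta> + \<epsilon>)))) 0)"

definition petz_renyi_information ::
  "(real^'l \<Rightarrow> complex^'n^'n) \<Rightarrow> real^'l \<Rightarrow> real \<Rightarrow> real^'l^'l" where
  "petz_renyi_information \<rho> \<theta> \<alpha> =
     (if \<alpha> = 1 then Lim (at 1) (petz_renyi_hessian \<rho> \<theta>) else petz_renyi_hessian \<rho> \<theta> \<alpha>)"

definition real_pos_semidef :: "real^'l^'l \<Rightarrow> bool" where
  "real_pos_semidef A \<longleftrightarrow> transpose A = A \<and> (\<forall>x. 0 \<le> x \<bullet> (A *v x))"

definition loewner_le :: "real^'l^'l \<Rightarrow> real^'l^'l \<Rightarrow> bool" where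
  "loewner_le A B \<longleftrightarrow> real_pos_semidef (B - A)"

definition twice_differentiable :: "(real^'l \<Rightarrow> 'b::real_normed_vector) \<Rightarrow> bool" where
  "twice_differentiable f \<longleftrightarrow> (\<exists>f' :: real^'l \<Rightarrow> (real^'l) \<Rightarrow>\<^sub>L 'b.
     (\<forall>x. (f has_derivative blinfun_apply (f' x)) (at x)) \<and>
     (\<forall>x. f' differentiable (at x)))"

end

theory Submission
  imports Defs
begin

text \<open>
  For every base point the gradient of \<open>D\<^sub>\<alpha>(\<rho>(\<theta>) \<parallel> \<sigma>)\<close> at \<open>\<sigma> = \<rho>(\<theta>)\<close> vanishes, because
  \<open>Tr[\<rho>\<^sup>\<alpha> d(\<rho>\<^sup>1\<^sup>-\<^sup>\<alpha>)] = (1 - \<alpha>) Tr[d\<rho>] = 0\<close>. Hence the Hessian in the second argument is minus the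
  mixed Hessian in both arguments, and only first derivatives of matrix powers enter:
  \<open>[I\<^sub>\<alpha>]\<^sub>i\<^sub>j = Tr[\<partial>\<^sub>i(\<rho>\<^sup>\<alpha>) \<partial>\<^sub>j(\<rho>\<^sup>1\<^sup>-\<^sup>\<alpha>)] / (\<alpha> (1 - \<alpha>))\<close>. These derivatives are obtained from the binomial
  series of \<open>x\<^sup>p\<close> around \<open>1\<close>, which converges since the eigenvalues of a positive definite state lie
  in \<open>(0, 1]\<close>. In an eigenbasis of \<open>\<rho>(\<theta>)\<close> the information matrix is a Gram matrix with the weights
  \<open>(x\<^sup>\<alpha> - y\<^sup>\<alpha>) (x\<^sup>1\<^sup>-\<^sup>\<alpha> - y\<^sup>1\<^sup>-\<^sup>\<alpha>) / (\<alpha> (1 - \<alpha>) (x - y)\<^sup>2)\<close> at pairs \<open>x\<close>, \<open>y\<close> of eigenvalues. With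
  \<open>t = (ln x - ln y) / 2\<close> and \<open>u = \<bar>2\<alpha> - 1\<bar>\<close> such a weight is a positive constant times
  \<open>(cosh t - cosh (u t)) / (1 - u\<^sup>2)\<close>, which increases with \<open>u\<close> as a secant slope of the convex
  function \<open>v \<mapsto> cosh (t \<surd>v)\<close>.
\<close>

subsection \<open>The spectral theorem\<close>

text \<open>Conjugate-linear in the first argument. Its real part is the real inner product
  \<open>x \<bullet> y\<close>, so compactness and dimension arguments can run over the underlying
  real space.\<close>

definition cinner :: "complex^'n \<Rightarrow> complex^'n \<Rightarrow> complex" where
  "cinner x y = (\<Sum>i\<in>UNIV. cnj (x $ i) * y $ i)"

lemma quadratic_form_cinner: "quadratic_form A x = cinner x (A *v x)"
  by (simp add: quadratic_form_def cinner_def)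

lemma inner_Re_cinner: "x \<bullet> y = Re (cinner x y)"
  by (simp add: cinner_def inner_vec_def inner_complex_def)

lemma cinner_add_right: "cinner x (y + z) = cinner x y + cinner x z"
  by (simp add: cinner_def algebra_simps sum.distrib)

lemma cinner_mult_right: "cinner x (c *s y) = c * cinner x y"
  by (simp add: cinner_def sum_distrib_left algebra_simps)

lemma cinner_mult_left: "cinner (c *s x) y = cnj c * cinner x y"
  by (simp add: cinner_def sum_distrib_left algebra_simps)

lemma cinner_commute: "cinner y x = cnj (cinner x y)"
  by (simp add: cinner_def mult.commute)

lemma cinner_self: "cinner x x = of_real ((norm x)\<^sup>2)"
proof -
  have "Im (cinner x x) = 0"
    using cinner_commute[of x x] by (metis Reals_cnj_iff complex_is_Real_iff)
  moreover have "Re (cinner x x) = (norm x)\<^sup>2"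
    by (metis inner_Re_cinner power2_norm_eq_inner)
  ultimately show ?thesis by (simp add: complex_eq_iff)
qed

lemma cinner_adjoint: "cinner (A *v x) y = cinner x (adjoint_matrix A *v y)"
proof -
  have "cinner (A *v x) y = (\<Sum>i\<in>UNIV. \<Sum>j\<in>UNIV. cnj (A $ i $ j) * cnj (x $ j) * y $ i)"
    by (simp add: cinner_def matrix_vector_mult_def sum_distrib_right)
  also have "\<dots> = (\<Sum>j\<in>UNIV. \<Sum>i\<in>UNIV. cnj (A $ i $ j) * cnj (x $ j) * y $ i)"
    by (rule sum.swap)
  also have "\<dots> = cinner x (adjoint_matrix A *v y)"
    by (simp add: cinner_def matrix_vector_mult_def adjoint_matrix_def sum_distrib_left mult_ac)
  finally show ?thesis .
qed

text \<open>Real dimension count: \<open>S\<close> and its multiples by \<open>\<i>\<close> span a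
  real subspace of dimension at most \<open>2 * card S\<close>, which is less than twice the complex
  dimension. Real orthogonality to \<open>s\<close> and to \<open>\<i> *s s\<close> kills the real
  and imaginary parts of \<open>cinner s x\<close>.\<close>

lemma exists_orthogonal_vector:
  fixes S :: "(complex^'n) set"
  assumes "finite S" "card S < CARD('n)"
  obtains x where "x \<noteq> 0" "\<And>s. s \<in> S \<Longrightarrow> cinner s x = 0"
proof -
  let ?T = "S \<union> (\<lambda>s. \<i> *s s) ` S"
  have "dim ?T \<le> card ?T"
    using assms by (intro dim_le_card') auto
  also have "\<dots> \<le> card S + card S"
    using assms by (meson card_Un_le card_image_le add_left_mono le_trans)
  also have "\<dots> < DIM(complex^'n)"
    using assms by simp
  finally obtain x where x: "x \<noteq> 0" "\<And>y. y \<in> span ?T \<Longrightarrow> orthogonal x y"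
    using orthogonal_to_subspace_exists by metis
  have "cinner s x = 0" if "s \<in> S" for s
  proof -
    have "x \<bullet> s = 0" "x \<bullet> (\<i> *s s) = 0"
      using x(2)[of s] x(2)[of "\<i> *s s"] that by (auto simp: orthogonal_def intro: span_base)
    then have "Re (cinner s x) = 0" "Re (cnj \<i> * cinner s x) = 0"
      by (metis inner_commute inner_Re_cinner cinner_mult_left)+
    then show ?thesis by (simp add: complex_eq_iff)
  qed
  with x(1) show ?thesis using that by blast
qed

text \<open>The first-order condition at a maximum: a linear gain in \<open>t\<close> cannot be paid
  for by a quadratic term.\<close>

lemma nonneg_linear_perturbation:
  fixes a c :: real
  assumes "\<And>t. t > 0 \<Longrightarrow> 2 * t * a \<le> t\<^sup>2 * c"
  shows "a \<le> 0"
proof (rule ccontr)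
  assume "\<not> a \<le> 0"
  then have a: "a > 0" by simp
  \<comment> \<open>Small enough that \<open>t * c\<close> is at most \<open>a\<close>, whereas the
    hypothesis divided by \<open>t\<close> demands \<open>2 * a \<le> t * c\<close>.\<close>
  define t where "t = a / (\<bar>c\<bar> + 1)"
  have t: "t > 0" using a by (simp add: t_def add_nonneg_pos)
  have "2 * a \<le> t * c"
    using assms[OF t] t by (simp add: power2_eq_square)
  also have "\<dots> \<le> t * (\<bar>c\<bar> + 1)" using t by simp
  also have "\<dots> = a" by (simp add: t_def add_nonneg_eq_0_iff)
  finally show False using a by simp
qed

text \<open>Variational argument: the orthogonal complement \<open>V\<close> of the given
  eigenvectors is invariant under \<open>A\<close>, and the quadratic form \<open>q\<close> attains
  its maximum \<open>l\<close> on the compact unit sphere of \<open>V\<close>. A maximiser is an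
  eigenvector with eigenvalue \<open>l\<close>.\<close>

lemma eigenvector_in_orthogonal_complement:
  fixes A :: "complex^'n^'n"
  assumes A: "hermitian_matrix A"
    and eig: "\<And>s. s \<in> S \<Longrightarrow> \<exists>c::real. A *v s = of_real c *s s"
    and x0: "x0 \<noteq> 0" "\<And>s. s \<in> S \<Longrightarrow> cinner s x0 = 0"
  obtains x c where "norm x = 1" "\<And>s. s \<in> S \<Longrightarrow> cinner s x = 0" "A *v x = of_real (c::real) *s x"
proof -
  define V where "V = {x. \<forall>s\<in>S. cinner s x = 0}"
  have AV: "A *v x \<in> V" if "x \<in> V" for x
  proof -
    have "cinner s (A *v x) = 0" if s: "s \<in> S" for s
    proof -
      obtain c :: real where "A *v s = of_real c *s s" using eig[OF s] by blast
      then have "cinner s (A *v x) = cinner (of_real c *s s) x"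
        using A cinner_adjoint[of A s x] by (simp add: hermitian_matrix_def)
      then show ?thesis using \<open>x \<in> V\<close> s by (simp add: V_def cinner_mult_left)
    qed
    then show ?thesis by (simp add: V_def)
  qed
  have scaleR: "(r *\<^sub>R x :: complex^'n) = of_real r *s x" for r x
    by (simp add: vec_eq_iff scaleR_conv_of_real[where 'a = complex])
  have Vlin: "x + r *\<^sub>R y \<in> V" if "x \<in> V" "y \<in> V" for x y r
    using that by (simp add: V_def scaleR cinner_add_right cinner_mult_right)
  have Ascale: "A *v (r *\<^sub>R z) = r *\<^sub>R (A *v z)" for r z
    by (rule linear_cmul[OF matrix_vector_mul_linear])
  have V0: "0 \<in> V" by (simp add: V_def cinner_def)
  have cont: "continuous_on UNIV (\<lambda>x. cinner s x)" for s
    unfolding cinner_def by (intro continuous_intros)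
  have "closed V"
  proof -
    have "V = (\<Inter>s\<in>S. {x. cinner s x = 0})" by (auto simp: V_def)
    then show ?thesis
      by (auto intro!: closed_INT closed_Collect_eq cont continuous_on_const)
  qed
  then have cpt: "compact (sphere 0 1 \<inter> V)" by (intro compact_Int_closed compact_sphere)
  define q where "q x = x \<bullet> (A *v x)" for x
  have contq: "continuous_on (sphere 0 1 \<inter> V) q"
    unfolding q_def by (intro continuous_intros linear_continuous_on_compose[OF _ matrix_vector_mul_linear])
  have "x0 /\<^sub>R norm x0 \<in> sphere 0 1 \<inter> V"
    using x0 Vlin[OF V0, of x0 "inverse (norm x0)"] by (simp add: V_def)
  then obtain x where x: "x \<in> sphere 0 1 \<inter> V" and xmax: "\<And>y. y \<in> sphere 0 1 \<inter> V \<Longrightarrow> q y \<le> q x"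
    using continuous_attains_sup[OF cpt _ contq] by blast
  define l where "l = q x"
  have nx: "norm x = 1" and xV: "x \<in> V" using x by auto
  have bound: "q y \<le> l * (y \<bullet> y)" if "y \<in> V" for y
  proof (cases "y = 0")
    case False
    have "q (y /\<^sub>R norm y) \<le> l"
      unfolding l_def using False Vlin[OF V0 that, of "inverse (norm y)"] by (intro xmax) auto
    moreover have "q (y /\<^sub>R norm y) = q y / (y \<bullet> y)"
      by (simp add: q_def Ascale inverse_eq_divide power2_norm_eq_inner[symmetric] power2_eq_square)
    ultimately show ?thesis using False by (simp add: divide_le_eq)
  qed (simp add: q_def)
  \<comment> \<open>The residual stays in \<open>V\<close> by invariance, so
    \<open>x + t *\<^sub>R w\<close> is an admissible competitor. Comparing it with the maximiser to
    first order in \<open>t\<close> forces \<open>w = 0\<close>.\<close>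
  define w where "w = A *v x - l *\<^sub>R x"
  have wV: "w \<in> V" using Vlin[OF AV[OF xV] xV, of "-l"] by (simp add: w_def)
  have sym: "y \<bullet> (A *v z) = z \<bullet> (A *v y)" for y z
    using A cinner_adjoint[of A y z] by (metis hermitian_matrix_def inner_Re_cinner inner_commute)
  have "w \<bullet> w \<le> 0"
  proof (rule nonneg_linear_perturbation)
    fix t :: real assume "t > 0"
    have "q (x + t *\<^sub>R w) = q x + 2 * t * (w \<bullet> (A *v x)) + t\<^sup>2 * q w"
      using sym[of x w]
      by (simp add: q_def matrix_vector_right_distrib Ascale inner_add_left inner_add_right
          power2_eq_square algebra_simps)
    moreover have "q (x + t *\<^sub>R w) \<le> l * (1 + 2 * t * (w \<bullet> x) + t\<^sup>2 * (w \<bullet> w))"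
    proof -
      have "(x + t *\<^sub>R w) \<bullet> (x + t *\<^sub>R w) = 1 + 2 * t * (w \<bullet> x) + t\<^sup>2 * (w \<bullet> w)"
      using nx by (simp add: norm_eq_1 inner_add_left inner_add_right inner_commute[of x w] power2_eq_square algebra_simps)
      then show ?thesis using bound[OF Vlin[OF xV wV, of t]] by metis
    qed
    ultimately have "2 * t * (w \<bullet> (A *v x)) + t\<^sup>2 * q w \<le> l * (2 * t * (w \<bullet> x) + t\<^sup>2 * (w \<bullet> w))"
      by (simp add: l_def algebra_simps)
    moreover have "w \<bullet> (A *v x) = w \<bullet> w + l * (w \<bullet> x)"
      by (metis inner_diff_right inner_scaleR_right w_def diff_add_cancel)
    ultimately show "2 * t * (w \<bullet> w) \<le> t\<^sup>2 * (l * (w \<bullet> w) - q w)"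
      by (simp add: algebra_simps)
  qed
  then have "w = 0" by (metis inner_gt_zero_iff not_le)
  then have "A *v x = of_real l *s x" by (simp add: w_def scaleR)
  then show ?thesis using that nx xV by (auto simp: V_def)
qed

text \<open>Induction on \<open>k\<close>: below the full dimension some nonzero vector is
  orthogonal to all eigenvectors found so far, and the complement then supplies a further
  one.\<close>

lemma orthonormal_eigenvectors:
  fixes A :: "complex^'n^'n"
  assumes A: "hermitian_matrix A" and "k \<le> CARD('n)"
  shows "\<exists>S. finite S \<and> card S = k \<and> (\<forall>s\<in>S. norm s = 1 \<and> (\<exists>c::real. A *v s = of_real c *s s)) \<and>
    (\<forall>s\<in>S. \<forall>t\<in>S. s \<noteq> t \<longrightarrow> cinner s t = 0)"
  using assms(2)
proof (induction k)
  case 0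
  show ?case by (intro exI[of _ "{}"]) auto
next
  case (Suc k)
  then obtain S where S: "finite S" "card S = k"
    "\<And>s. s \<in> S \<Longrightarrow> norm s = 1" "\<And>s. s \<in> S \<Longrightarrow> \<exists>c::real. A *v s = of_real c *s s"
    "\<And>s t. s \<in> S \<Longrightarrow> t \<in> S \<Longrightarrow> s \<noteq> t \<Longrightarrow> cinner s t = 0" by auto
  obtain x0 where "x0 \<noteq> 0" "\<And>s. s \<in> S \<Longrightarrow> cinner s x0 = 0"
    using exists_orthogonal_vector[of S] S(1,2) Suc.prems by auto
  then obtain x c where x: "norm x = 1" "\<And>s. s \<in> S \<Longrightarrow> cinner s x = 0" "A *v x = of_real (c::real) *s x"
    using eigenvector_in_orthogonal_complement[OF A S(4)] by metis
  have "x \<notin> S" using x(1,2) cinner_self[of x] by auto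
  moreover have "cinner x s = 0" if "s \<in> S" for s using x(2)[OF that] by (simp add: cinner_commute[of x s])
  ultimately show ?case
    using S x by (intro exI[of _ "insert x S"]) auto
qed

theorem spectral_decomposition:
  fixes A :: "complex^'n^'n"
  assumes A: "hermitian_matrix A"
  obtains U d where "unitary_matrix U" "A = U ** real_diag d ** adjoint_matrix U"
proof -
  obtain S where S: "finite S" "card S = CARD('n)"
    "\<And>s. s \<in> S \<Longrightarrow> norm s = 1" "\<And>s. s \<in> S \<Longrightarrow> \<exists>c::real. A *v s = of_real c *s s"
    "\<And>s t. s \<in> S \<Longrightarrow> t \<in> S \<Longrightarrow> s \<noteq> t \<Longrightarrow> cinner s t = 0"
    using orthonormal_eigenvectors[OF A order_refl] by blast
  obtain f :: "'n \<Rightarrow> complex^'n" where f: "bij_betw f UNIV S"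
    using S(1,2) finite_same_card_bij[of "UNIV :: 'n set" S] by auto
  have fS: "f j \<in> S" for j using f by (auto simp: bij_betw_def)
  obtain d :: "'n \<Rightarrow> real" where d: "\<And>j. A *v f j = of_real (d j) *s f j"
    using S(4)[OF fS] by metis
  have on: "cinner (f i) (f j) = (if i = j then 1 else 0)" for i j
    using S(3)[OF fS, of j] S(5)[OF fS[of i] fS[of j]] bij_betw_imp_inj_on[OF f]
    by (auto simp: cinner_self dest: injD)
  define U :: "complex^'n^'n" where "U = (\<chi> i j. f j $ i)"
  have "adjoint_matrix U ** U = mat 1"
    using on by (simp add: vec_eq_iff matrix_matrix_mult_def adjoint_matrix_def U_def mat_def cinner_def)
  then have U: "unitary_matrix U"
    by (simp add: unitary_matrix_def matrix_left_right_inverse)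
  have "A ** U = U ** real_diag d"
    using d by (simp add: vec_eq_iff matrix_matrix_mult_def real_diag_def U_def matrix_vector_mult_def if_distrib
        mult.commute cong: if_cong)
  then have "A = U ** real_diag d ** adjoint_matrix U"
    using U by (metis matrix_mul_assoc matrix_mul_rid unitary_matrix_def)
  with U show ?thesis using that by blast
qed

section \<open>Functional calculus and conjugation by unitaries\<close>

lemma matrix_mult_real_diag: "(A ** real_diag d) $ i $ j = A $ i $ j * of_real (d j)"
  by (simp add: matrix_matrix_mult_def real_diag_def if_distrib cong: if_cong)

lemma real_diag_mult_matrix: "(real_diag d ** A) $ i $ j = of_real (d i) * A $ i $ j"
proof -
  have "(if i = k then of_real (d i) else 0) * A $ k $ j = (if i = k then of_real (d i) * A $ k $ j else 0)" for k
    by simp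
  then show ?thesis by (simp add: matrix_matrix_mult_def real_diag_def)
qed

text \<open>Independence of the decomposition: the change of basis \<open>W\<close> intertwines the
  two diagonals, so \<open>W $ i $ j\<close> can be nonzero only where \<open>d j = e i\<close>.
  Hence \<open>W\<close> also intertwines their images under \<open>f\<close>.\<close>

lemma matrix_fun_eq:
  assumes U: "unitary_matrix U" and A: "A = U ** real_diag d ** adjoint_matrix U"
  shows "matrix_fun f A = U ** real_diag (f \<circ> d) ** adjoint_matrix U"
  unfolding matrix_fun_def
proof (rule the_equality)
  show "\<exists>U' d'. unitary_matrix U' \<and> A = U' ** real_diag d' ** adjoint_matrix U' \<and>
      U ** real_diag (f \<circ> d) ** adjoint_matrix U = U' ** real_diag (f \<circ> d') ** adjoint_matrix U'"
    using assms by blast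
next
  fix B assume "\<exists>V e. unitary_matrix V \<and> A = V ** real_diag e ** adjoint_matrix V \<and>
      B = V ** real_diag (f \<circ> e) ** adjoint_matrix V"
  then obtain V e where V: "unitary_matrix V" and A': "A = V ** real_diag e ** adjoint_matrix V"
    and B: "B = V ** real_diag (f \<circ> e) ** adjoint_matrix V" by blast
  define W where "W = adjoint_matrix V ** U"
  have "adjoint_matrix V ** A ** U = W ** real_diag d"
    using U by (metis A W_def matrix_mul_assoc matrix_mul_rid unitary_matrix_def)
  moreover have "adjoint_matrix V ** A ** U = real_diag e ** W"
    using V by (metis A' W_def matrix_mul_assoc matrix_mul_lid unitary_matrix_def)
  ultimately have "W $ i $ j * of_real (d j) = of_real (e i) * W $ i $ j" for i j
    by (metis matrix_mult_real_diag real_diag_mult_matrix)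
  then have "W $ i $ j = 0 \<or> d j = e i" for i j
    by (metis mult.commute mult_cancel_left of_real_eq_iff)
  then have "W $ i $ j * of_real (f (d j)) = of_real (f (e i)) * W $ i $ j" for i j
    by (metis mult.commute mult_zero_left)
  then have "W ** real_diag (f \<circ> d) = real_diag (f \<circ> e) ** W"
    by (simp add: vec_eq_iff matrix_mult_real_diag real_diag_mult_matrix)
  then have "V ** (W ** real_diag (f \<circ> d)) ** adjoint_matrix U = V ** (real_diag (f \<circ> e) ** W) ** adjoint_matrix U"
    by simp
  moreover have "V ** (W ** real_diag (f \<circ> d)) ** adjoint_matrix U = U ** real_diag (f \<circ> d) ** adjoint_matrix U"
    using V by (metis W_def matrix_mul_assoc matrix_mul_lid unitary_matrix_def)
  moreover have "V ** (real_diag (f \<circ> e) ** W) ** adjoint_matrix U = B"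
    using U by (metis B W_def matrix_mul_assoc matrix_mul_rid unitary_matrix_def)
  ultimately show "B = U ** real_diag (f \<circ> d) ** adjoint_matrix U" by simp
qed

lemma matrix_conj_entry:
  "(U ** M ** adjoint_matrix V) $ i $ j = (\<Sum>a\<in>UNIV. \<Sum>b\<in>UNIV. U $ i $ a * M $ a $ b * cnj (V $ j $ b))"
proof -
  have "(U ** M ** adjoint_matrix V) $ i $ j = (\<Sum>b\<in>UNIV. \<Sum>a\<in>UNIV. U $ i $ a * M $ a $ b * cnj (V $ j $ b))"
    by (simp add: matrix_matrix_mult_def adjoint_matrix_def sum_distrib_right)
  also have "\<dots> = (\<Sum>a\<in>UNIV. \<Sum>b\<in>UNIV. U $ i $ a * M $ a $ b * cnj (V $ j $ b))"
    by (rule sum.swap)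
  finally show ?thesis .
qed

lemma adjoint_matrix_adjoint [simp]: "adjoint_matrix (adjoint_matrix A) = A"
  by (simp add: adjoint_matrix_def vec_eq_iff)

lemma adjoint_matrix_mult: "adjoint_matrix (A ** B) = adjoint_matrix B ** adjoint_matrix A"
  by (simp add: adjoint_matrix_def vec_eq_iff matrix_matrix_mult_def mult.commute)

lemma unitary_matrix_adjoint: "unitary_matrix U \<Longrightarrow> unitary_matrix (adjoint_matrix U)"
  by (simp add: unitary_matrix_def)

lemma unitary_cancel_left:
  assumes "unitary_matrix U"
  shows "adjoint_matrix U ** (U ** A) = A" "U ** (adjoint_matrix U ** A) = A"
  using assms by (simp_all add: matrix_mul_assoc unitary_matrix_def)

lemma unitary_column_norm:
  assumes "unitary_matrix U"
  shows "(\<Sum>i\<in>UNIV. (cmod (U $ i $ j))\<^sup>2) = 1"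
proof -
  have "(adjoint_matrix U ** U) $ j $ j = 1"
    using assms by (simp add: unitary_matrix_def mat_def)
  then have "(\<Sum>i\<in>UNIV. cnj (U $ i $ j) * U $ i $ j) = 1"
    by (simp add: matrix_matrix_mult_def adjoint_matrix_def)
  then have "complex_of_real (\<Sum>i\<in>UNIV. (cmod (U $ i $ j))\<^sup>2) = 1"
    by (simp add: complex_norm_square mult.commute del: of_real_power)
  then show ?thesis using of_real_eq_1_iff by blast
qed

lemma unitary_entry_le_1:
  assumes "unitary_matrix U"
  shows "cmod (U $ i $ j) \<le> 1"
proof -
  have "(cmod (U $ i $ j))\<^sup>2 \<le> (\<Sum>i\<in>UNIV. (cmod (U $ i $ j))\<^sup>2)"
    by (rule member_le_sum) auto
  then show ?thesis
    using unitary_column_norm[OF assms, of j] by (simp add: power_le_one_iff abs_square_le_1)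
qed

text \<open>Crude, but the bound is the same for all \<open>U\<close> and \<open>V\<close>. This
  matters because eigenbases need not vary continuously with the state.\<close>

lemma unitary_conj_entry_le:
  assumes "unitary_matrix U" "unitary_matrix V"
  shows "cmod ((U ** M ** adjoint_matrix V) $ i $ j) \<le> (\<Sum>a\<in>UNIV. \<Sum>b\<in>UNIV. cmod (M $ a $ b))"
proof -
  have "cmod (U $ i $ a * M $ a $ b * cnj (V $ j $ b)) \<le> cmod (M $ a $ b)" for a b
  proof -
    have "cmod (U $ i $ a) * cmod (M $ a $ b) * cmod (V $ j $ b) \<le> 1 * cmod (M $ a $ b) * 1"
      using unitary_entry_le_1[OF assms(1)] unitary_entry_le_1[OF assms(2)]
      by (intro mult_mono) auto
    then show ?thesis by (simp add: norm_mult)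
  qed
  then show ?thesis
    unfolding matrix_conj_entry by (intro sum_norm_le order_trans[OF norm_sum] sum_mono)
qed

subsection \<open>Divided differences of powers\<close>

primrec matpow :: "complex^'n^'n \<Rightarrow> nat \<Rightarrow> complex^'n^'n" where
  "matpow A 0 = mat 1"
| "matpow A (Suc k) = A ** matpow A k"

lemma real_diag_mult: "real_diag d ** real_diag e = real_diag (\<lambda>i. d i * e i)"
  by (auto simp: vec_eq_iff matrix_mult_real_diag) (auto simp: real_diag_def)

lemma real_diag_one: "real_diag (\<lambda>_. 1) = mat 1"
  by (simp add: vec_eq_iff real_diag_def mat_def)

lemma matpow_spectral:
  assumes "unitary_matrix U"
  shows "matpow (U ** real_diag d ** adjoint_matrix U) k = U ** real_diag (\<lambda>i. d i ^ k) ** adjoint_matrix U"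
proof (induction k)
  case 0
  show ?case using assms by (simp add: real_diag_one unitary_matrix_def)
next
  case (Suc k)
  have "matpow (U ** real_diag d ** adjoint_matrix U) (Suc k) = U ** (real_diag d ** real_diag (\<lambda>i. d i ^ k)) ** adjoint_matrix U"
    unfolding matpow.simps Suc using assms by (simp add: unitary_cancel_left flip: matrix_mul_assoc)
  then show ?case by (simp add: real_diag_mult)
qed

text \<open>\<open>matpow_diff k X Y H = (\<Sum>i<k. X^i H Y^(k-1-i))\<close>, so that
  \<open>X^k - Y^k = matpow_diff k X Y (X - Y)\<close>.\<close>

primrec matpow_diff :: "nat \<Rightarrow> complex^'n^'n \<Rightarrow> complex^'n^'n \<Rightarrow> complex^'n^'n \<Rightarrow> complex^'n^'n" where
  "matpow_diff 0 X Y H = 0"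
| "matpow_diff (Suc k) X Y H = H ** matpow Y k + X ** matpow_diff k X Y H"

text \<open>The divided difference of \<open>z \<mapsto> z ^ k\<close>, written without division so
  that the diagonal \<open>x = y\<close> is included.\<close>

primrec pow_quot :: "nat \<Rightarrow> real \<Rightarrow> real \<Rightarrow> real" where
  "pow_quot 0 x y = 0"
| "pow_quot (Suc k) x y = y ^ k + x * pow_quot k x y"

lemma pow_quot_mult: "(x - y) * pow_quot k x y = x ^ k - y ^ k"
proof (induction k)
  case (Suc k)
  have "(x - y) * pow_quot (Suc k) x y = (x - y) * y ^ k + x * ((x - y) * pow_quot k x y)"
    by (simp add: algebra_simps)
  then show ?case by (simp only: Suc) (simp add: algebra_simps)
qed simp

lemma pow_quot_same: "pow_quot k x x = real k * x ^ (k - 1)"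
  by (induction k) (auto simp: algebra_simps power_eq_if)

lemma abs_pow_quot_le:
  assumes "\<bar>x\<bar> \<le> r" "\<bar>y\<bar> \<le> r"
  shows "\<bar>pow_quot k x y\<bar> \<le> real k * r ^ (k - 1)"
proof (induction k)
  case (Suc k)
  have r: "r \<ge> 0" using assms by linarith
  have "\<bar>pow_quot (Suc k) x y\<bar> \<le> \<bar>y\<bar> ^ k + \<bar>x\<bar> * \<bar>pow_quot k x y\<bar>"
    by (simp add: abs_mult power_abs order_trans[OF abs_triangle_ineq])
  also have "\<dots> \<le> r ^ k + r * (real k * r ^ (k - 1))"
    using assms r Suc by (intro add_mono mult_mono power_mono) auto
  also have "\<dots> = real (Suc k) * r ^ (Suc k - 1)"
    by (cases k) (auto simp: algebra_simps)
  finally show ?case .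
qed simp

lemma matrix_add_rdistrib: "(A + B) ** (C :: complex^'k^'n) = A ** C + B ** C"
  by (simp add: matrix_matrix_mult_def vec_eq_iff sum.distrib algebra_simps)

text \<open>Between the eigenbasis of the left argument and that of the right one,
  \<open>matpow_diff\<close> acts as an entrywise multiplication by scalar divided differences. Two
  separate bases are kept so that difference quotients at distinct states are covered.\<close>

lemma matpow_diff_spectral:
  assumes U: "unitary_matrix U" and V: "unitary_matrix V"
  shows "matpow_diff k (U ** real_diag x ** adjoint_matrix U) (V ** real_diag y ** adjoint_matrix V) H =
    U ** (\<chi> a b. of_real (pow_quot k (x a) (y b)) * (adjoint_matrix U ** H ** V) $ a $ b) ** adjoint_matrix V"
proof (induction k)
  case 0
  show ?case by (simp add: matrix_matrix_mult_def vec_eq_iff)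
next
  case (Suc k)
  let ?M = "\<lambda>k. \<chi> a b. of_real (pow_quot k (x a) (y b)) * (adjoint_matrix U ** H ** V) $ a $ b"
  have "?M (Suc k) = adjoint_matrix U ** H ** V ** real_diag (\<lambda>i. y i ^ k) + real_diag x ** ?M k"
    by (simp add: vec_eq_iff matrix_mult_real_diag real_diag_mult_matrix algebra_simps)
  then have "U ** ?M (Suc k) ** adjoint_matrix V =
    U ** (adjoint_matrix U ** H ** V ** real_diag (\<lambda>i. y i ^ k)) ** adjoint_matrix V + U ** (real_diag x ** ?M k) ** adjoint_matrix V"
    by (simp add: matrix_add_ldistrib matrix_add_rdistrib)
  also have "U ** (adjoint_matrix U ** H ** V ** real_diag (\<lambda>i. y i ^ k)) ** adjoint_matrix V
    = H ** matpow (V ** real_diag y ** adjoint_matrix V) k"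
    unfolding matpow_spectral[OF V] using U by (simp add: unitary_cancel_left flip: matrix_mul_assoc)
  also have "U ** (real_diag x ** ?M k) ** adjoint_matrix V =
    (U ** real_diag x ** adjoint_matrix U) ** matpow_diff k (U ** real_diag x ** adjoint_matrix U) (V ** real_diag y ** adjoint_matrix V) H"
    unfolding Suc using U by (simp add: unitary_cancel_left flip: matrix_mul_assoc)
  finally show ?case by simp
qed

section \<open>Continuity of matrix polynomials\<close>

lemma tendsto_matrix_mult [tendsto_intros]:
  fixes f :: "'a \<Rightarrow> complex^'n^'m" and g :: "'a \<Rightarrow> complex^'k^'n"
  assumes "(f \<longlongrightarrow> a) F" "(g \<longlongrightarrow> b) F"
  shows "((\<lambda>x. f x ** g x) \<longlongrightarrow> a ** b) F"
  unfolding matrix_matrix_mult_def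
  by (intro vec_tendstoI) (simp, intro tendsto_intros assms)

lemma tendsto_matpow [tendsto_intros]:
  "(f \<longlongrightarrow> a) F \<Longrightarrow> ((\<lambda>x. matpow (f x) k) \<longlongrightarrow> matpow a k) F"
  by (induction k) (auto intro!: tendsto_intros)

lemma tendsto_matpow_diff [tendsto_intros]:
  "(f \<longlongrightarrow> a) F \<Longrightarrow> (g \<longlongrightarrow> b) F \<Longrightarrow> (h \<longlongrightarrow> c) F \<Longrightarrow>
    ((\<lambda>x. matpow_diff k (f x) (g x) (h x)) \<longlongrightarrow> matpow_diff k a b c) F"
  by (induction k) (auto intro!: tendsto_intros)

section \<open>Scalar real powers and the binomial series\<close>

definition powr_quot :: "real \<Rightarrow> real \<Rightarrow> real \<Rightarrow> real" where
  "powr_quot p x y = (if x = y then p * x powr (p - 1) else (x powr p - y powr p) / (x - y))"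

lemma powr_quot_mult: "powr_quot p x y * (x - y) = x powr p - y powr p"
  by (simp add: powr_quot_def)

lemma powr_quot_commute: "powr_quot p x y = powr_quot p y x"
  by (auto simp: powr_quot_def divide_simps) argo

lemma summable_gbinomial_deriv:
  fixes p z :: real
  assumes "\<bar>z\<bar> < 1"
  shows "summable (\<lambda>n. diffs (\<lambda>n. p gchoose n) n * z ^ n)"
proof (rule termdiff_converges)
  show "norm z < 1" using assms by simp
  show "summable (\<lambda>n. (p gchoose n) * x ^ n)" if "norm x < 1" for x :: real
    using gen_binomial_real[of x p] that by (simp add: sums_iff)
qed

text \<open>The majorant for the later exchange of limit and series. The differentiated binomial
  series converges at some \<open>s\<close> between \<open>r\<close> and \<open>1\<close>, hence
  absolutely at \<open>r\<close>. The truncated exponent \<open>n - 1\<close> at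
  \<open>n = 0\<close> is harmless, as the factor \<open>real n\<close> vanishes there.\<close>

lemma summable_abs_gbinomial_deriv:
  fixes p r :: real
  assumes "0 \<le> r" "r < 1"
  shows "summable (\<lambda>n. \<bar>p gchoose n\<bar> * (real n * r ^ (n - 1)))"
proof -
  obtain s where s: "r < s" "s < 1" using assms dense by blast
  have "summable (\<lambda>n. norm (diffs (\<lambda>n. p gchoose n) n * r ^ n))"
    using summable_gbinomial_deriv[of s p] s assms by (intro powser_insidea[of _ s]) auto
  then have "summable (\<lambda>n. \<bar>p gchoose (Suc n)\<bar> * (real (Suc n) * r ^ (Suc n - 1)))"
    using assms by (simp add: diffs_def abs_mult mult_ac)
  then show ?thesis by (subst (asm) summable_Suc_iff)
qed

text \<open>Off the diagonal this is the difference of two binomial series divided by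
  \<open>x - y\<close>; on the diagonal it is the termwise derivative of one such series.\<close>

lemma powr_quot_sums:
  assumes "0 < x" "x < 2" "0 < y" "y < 2"
  shows "(\<lambda>k. (p gchoose k) * pow_quot k (x - 1) (y - 1)) sums powr_quot p x y"
proof (cases "x = y")
  case False
  have s: "(\<lambda>k. (p gchoose k) * (z - 1) ^ k) sums (z powr p)" if "0 < z" "z < 2" for z :: real
    using gen_binomial_real[of "z - 1" p] that by (simp add: abs_if)
  have "(\<lambda>k. ((p gchoose k) * (x - 1) ^ k - (p gchoose k) * (y - 1) ^ k) / (x - y)) sums ((x powr p - y powr p) / (x - y))"
    using assms by (intro sums_divide sums_diff s)
  moreover have "((p gchoose k) * (x - 1) ^ k - (p gchoose k) * (y - 1) ^ k) / (x - y) = (p gchoose k) * pow_quot k (x - 1) (y - 1)" for k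
    using False pow_quot_mult[of "x - 1" "y - 1" k] by (simp add: divide_eq_eq flip: right_diff_distrib) (simp add: algebra_simps)
  ultimately show ?thesis using False by (simp add: powr_quot_def)
next
  case True
  define z where "z = x - 1"
  have z: "\<bar>z\<bar> < 1" using assms by (auto simp: z_def abs_if)
  obtain K where K: "\<bar>z\<bar> < K" "K < 1" using z dense by blast
  have K0: "0 < K" using K(1) by linarith
  have gb: "(\<lambda>n. (p gchoose n) * w ^ n) sums (1 + w) powr p" if "\<bar>w\<bar> < 1" for w :: real
    using gen_binomial_real[of w p] that by simp
  have "((\<lambda>w. \<Sum>n. (p gchoose n) * w ^ n) has_real_derivative (\<Sum>n. diffs (\<lambda>n. p gchoose n) n * z ^ n)) (at z)"
    using K K0 gb[of K] by (intro termdiffs_strong[of _ K]) (auto simp: sums_iff)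
  \<comment> \<open>The series equals \<open>(1 + w) powr p\<close> on a whole neighbourhood of
    \<open>z\<close>, so uniqueness of the derivative evaluates the differentiated series.\<close>
  moreover have "eventually (\<lambda>w. w \<in> {-1<..<1}) (nhds z)"
    using z by (intro eventually_nhds_in_open) auto
  then have "eventually (\<lambda>w. (\<Sum>n. (p gchoose n) * w ^ n) = (1 + w) powr p) (nhds z)"
    by eventually_elim (use gb in \<open>auto simp: abs_less_iff sums_iff\<close>)
  ultimately have "((\<lambda>w. (1 + w) powr p) has_real_derivative (\<Sum>n. diffs (\<lambda>n. p gchoose n) n * z ^ n)) (at z)"
    by (subst (asm) DERIV_cong_ev[OF refl _ refl])
  moreover have "((\<lambda>w. (1 + w) powr p) has_real_derivative p * (1 + z) powr (p - 1)) (at z)"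
    using z by (auto intro!: derivative_eq_intros simp: abs_less_iff)
  ultimately have "(\<Sum>n. diffs (\<lambda>n. p gchoose n) n * z ^ n) = p * (1 + z) powr (p - 1)"
    by (rule DERIV_unique)
  then have "(\<lambda>n. diffs (\<lambda>n. p gchoose n) n * z ^ n) sums (p * (1 + z) powr (p - 1))"
    using summable_gbinomial_deriv[OF z, of p] by (simp add: sums_iff)
  then have "(\<lambda>n. (p gchoose (Suc n)) * pow_quot (Suc n) z z) sums (p * (1 + z) powr (p - 1))"
    by (simp add: diffs_def pow_quot_same mult_ac del: pow_quot.simps)
  \<comment> \<open>The index shift adds nothing because \<open>pow_quot 0\<close> is zero.\<close>
  then have "(\<lambda>n. (p gchoose n) * pow_quot n z z) sums (p * (1 + z) powr (p - 1))"
    by (subst (asm) sums_Suc_iff) simp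
  then show ?thesis using True by (simp add: powr_quot_def z_def)
qed

subsection \<open>Divided differences of matrix powers\<close>

lemma trace_unitary_conj:
  assumes "unitary_matrix U"
  shows "trace (U ** M ** adjoint_matrix U) = trace M"
  using assms trace_mul_sym[of "U ** M" "adjoint_matrix U"]
  by (simp add: unitary_cancel_left)

lemma Re_quadratic_form: "Re (quadratic_form A x) = x \<bullet> (A *v x)"
  by (simp add: quadratic_form_cinner inner_Re_cinner)

lemma inner_matrix_vector_le:
  fixes A :: "complex^'n^'n"
  assumes "norm v = 1"
  shows "\<bar>v \<bullet> (A *v v)\<bar> \<le> (\<Sum>i\<in>UNIV. \<Sum>j\<in>UNIV. cmod (A $ i $ j))"
proof -
  have v: "cmod (v $ i) \<le> 1" for i
    using Finite_Cartesian_Product.norm_nth_le[of v i] assms by simp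
  have "cmod (A $ i $ j * v $ j) \<le> cmod (A $ i $ j)" for i j
    using mult_left_mono[OF v, of "cmod (A $ i $ j)"] by (simp add: norm_mult)
  then have row: "cmod ((A *v v) $ i) \<le> (\<Sum>j\<in>UNIV. cmod (A $ i $ j))" for i
    unfolding matrix_vector_mult_def by (auto intro!: sum_norm_le)
  have "cmod (cnj (v $ i) * (A *v v) $ i) \<le> 1 * (\<Sum>j\<in>UNIV. cmod (A $ i $ j))" for i
    unfolding norm_mult using v row by (intro mult_mono) auto
  then have "cmod (cinner v (A *v v)) \<le> (\<Sum>i\<in>UNIV. \<Sum>j\<in>UNIV. cmod (A $ i $ j))"
    unfolding cinner_def by (intro sum_norm_le) simp
  then show ?thesis
    using abs_Re_le_cmod[of "cinner v (A *v v)"] by (simp add: inner_Re_cinner)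
qed

section \<open>Spectra of positive definite states\<close>

lemma pos_def_lower_bound:
  fixes A :: "complex^'n^'n"
  assumes "pos_def A"
  obtains m where "m > 0" "\<And>v. norm v = 1 \<Longrightarrow> m \<le> v \<bullet> (A *v v)"
proof -
  have c: "continuous_on (sphere 0 1) (\<lambda>v. v \<bullet> (A *v v))"
    by (intro continuous_intros linear_continuous_on_compose[OF _ matrix_vector_mul_linear])
  have "axis (undefined :: 'n) (1 :: complex) \<in> sphere 0 1" by simp
  then obtain x where x: "x \<in> sphere 0 1" "\<And>v. v \<in> sphere 0 1 \<Longrightarrow> x \<bullet> (A *v x) \<le> v \<bullet> (A *v v)"
    using continuous_attains_inf[OF compact_sphere _ c] by blast
  have "x \<noteq> 0" using x(1) by auto
  then have "x \<bullet> (A *v x) > 0"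
    using assms by (simp add: pos_def_def Re_quadratic_form)
  then show ?thesis using x that by simp
qed

text \<open>On unit vectors the forms of \<open>f x\<close> and \<open>A\<close> differ by at most
  the sum of the entry moduli of \<open>f x - A\<close>, uniformly in the vector. Once this sum
  drops below half the lower bound for \<open>A\<close>, the other half remains.\<close>

lemma eventually_uniform_lower_bound:
  fixes f :: "'a \<Rightarrow> complex^'n^'n"
  assumes lim: "(f \<longlongrightarrow> A) F" and A: "pos_def A"
  obtains m where "m > 0" "eventually (\<lambda>x. \<forall>v. norm v = 1 \<longrightarrow> m \<le> v \<bullet> (f x *v v)) F"
proof -
  obtain m where m: "m > 0" "\<And>v. norm v = 1 \<Longrightarrow> m \<le> v \<bullet> (A *v v)"
    using pos_def_lower_bound[OF A] by blast
  have "((\<lambda>x. \<Sum>i\<in>UNIV. \<Sum>j\<in>UNIV. cmod ((f x - A) $ i $ j)) \<longlongrightarrow> (\<Sum>i\<in>UNIV. \<Sum>j\<in>UNIV. cmod ((A - A) $ i $ j))) F"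
    by (intro tendsto_intros lim)
  then have "eventually (\<lambda>x. (\<Sum>i\<in>UNIV. \<Sum>j\<in>UNIV. cmod ((f x - A) $ i $ j)) < m / 2) F"
    using m(1) by (intro order_tendstoD(2)[of _ 0]) auto
  then have "eventually (\<lambda>x. \<forall>v. norm v = 1 \<longrightarrow> m / 2 \<le> v \<bullet> (f x *v v)) F"
  proof eventually_elim
    case (elim x)
    show ?case
    proof (intro allI impI)
      fix v :: "complex^'n" assume v: "norm v = 1"
      have "v \<bullet> (f x *v v) = v \<bullet> (A *v v) + v \<bullet> ((f x - A) *v v)"
        by (simp add: matrix_vector_mult_diff_rdistrib inner_diff_right)
      then show "m / 2 \<le> v \<bullet> (f x *v v)"
        using inner_matrix_vector_le[OF v, of "f x - A"] m(2)[OF v] elim by linarith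
    qed
  qed
  then show ?thesis using m(1) that[of "m / 2"] by simp
qed

text \<open>Each eigenvalue is the value of the form at a unit column of \<open>U\<close>, which
  gives the lower bound. Nonnegative eigenvalues with sum \<open>1\<close> are at most
  \<open>1\<close>. Thus the spectrum of \<open>A - mat 1\<close> lies within distance
  \<open>1 - m\<close> of \<open>0\<close>, in reach of the binomial series when
  \<open>m > 0\<close>.\<close>

lemma state_spectral:
  fixes A :: "complex^'n^'n"
  assumes A: "state A" and m: "\<And>v. norm v = 1 \<Longrightarrow> m \<le> v \<bullet> (A *v v)" and "m \<ge> 0"
  obtains U d where "unitary_matrix U" "A = U ** real_diag d ** adjoint_matrix U"
    "\<And>i. m \<le> d i" "\<And>i. d i \<le> 1"
proof -
  have "hermitian_matrix A" using A by (simp add: state_def pos_semidef_def)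
  then obtain U d where U: "unitary_matrix U" and Aeq: "A = U ** real_diag d ** adjoint_matrix U"
    using spectral_decomposition by blast
  have AU: "A ** U = U ** real_diag d"
    unfolding Aeq using U by (simp add: unitary_matrix_def flip: matrix_mul_assoc)
  have d: "m \<le> d i" for i
  proof -
    define u where "u = column i U"
    have "A *v u = of_real (d i) *s u"
    proof -
      have "(A *v u) $ j = (A ** U) $ j $ i" for j
        by (simp add: u_def column_def matrix_vector_mult_def matrix_matrix_mult_def)
      then show ?thesis
        by (simp add: AU vec_eq_iff matrix_mult_real_diag u_def column_def mult.commute)
    qed
    moreover have nu: "norm u = 1"
      using unitary_column_norm[OF U, of i] by (simp add: norm_vec_def L2_set_def u_def column_def)
    ultimately have "u \<bullet> (A *v u) = d i"
      by (simp add: inner_Re_cinner cinner_mult_right cinner_self)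
    then show ?thesis using m[OF nu] by simp
  qed
  have "complex_of_real (\<Sum>i\<in>UNIV. d i) = trace (real_diag d)"
    by (simp add: trace_def real_diag_def)
  also have "\<dots> = 1"
    using A by (simp add: state_def Aeq trace_unitary_conj[OF U])
  finally have "(\<Sum>i\<in>UNIV. d i) = 1" using of_real_eq_1_iff by blast
  moreover have "d i \<le> (\<Sum>i\<in>UNIV. d i)" for i
    using d \<open>m \<ge> 0\<close> by (intro member_le_sum) (auto intro: order_trans)
  ultimately show ?thesis using that U Aeq d by metis
qed

lemma pos_def_state_spectral:
  fixes A :: "complex^'n^'n"
  assumes "state A" "pos_def A"
  obtains U d where "unitary_matrix U" "A = U ** real_diag d ** adjoint_matrix U"
    "\<And>i. 0 < d i" "\<And>i. d i \<le> 1"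
proof -
  obtain m where m: "m > 0" "\<And>v. norm v = 1 \<Longrightarrow> m \<le> v \<bullet> (A *v v)"
    using pos_def_lower_bound[OF assms(2)] by blast
  obtain U d where "unitary_matrix U" "A = U ** real_diag d ** adjoint_matrix U"
    "\<And>i. m \<le> d i" "\<And>i. d i \<le> 1"
    using state_spectral[OF assms(1) m(2)] m(1) by (metis order_less_imp_le)
  then show ?thesis using m(1) that[of U d] by (meson less_le_trans)
qed

text \<open>The divided difference of \<open>x \<mapsto> x^p\<close> at a pair of states, applied to \<open>H\<close>, written as a
  binomial series around the identity; at \<open>A = B\<close> it is the Frechet derivative.\<close>

definition matrix_powr_quot :: "real \<Rightarrow> complex^'n^'n \<Rightarrow> complex^'n^'n \<Rightarrow> complex^'n^'n \<Rightarrow> complex^'n^'n" where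
  "matrix_powr_quot p A B H =
    (\<chi> i j. \<Sum>k. of_real (p gchoose k) * matpow_diff k (A - mat 1) (B - mat 1) H $ i $ j)"

lemma spectral_minus_one:
  assumes "unitary_matrix U" "A = U ** real_diag d ** adjoint_matrix U"
  shows "A - mat 1 = U ** real_diag (\<lambda>i. d i - 1) ** adjoint_matrix U"
proof -
  have "real_diag d = real_diag (\<lambda>i. d i - 1) + mat 1"
    by (simp add: vec_eq_iff real_diag_def mat_def)
  then show ?thesis
    using assms by (simp add: matrix_add_ldistrib matrix_add_rdistrib unitary_matrix_def)
qed

text \<open>Each term of the series is an entrywise multiplication in the same two eigenbases, so
  the sum is taken weight by weight with \<open>powr_quot_sums\<close>.\<close>

lemma matrix_powr_quot_spectral:
  assumes U: "unitary_matrix U" "A = U ** real_diag x ** adjoint_matrix U"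
    and V: "unitary_matrix V" "B = V ** real_diag y ** adjoint_matrix V"
    and x: "\<And>i. 0 < x i" "\<And>i. x i \<le> 1" and y: "\<And>i. 0 < y i" "\<And>i. y i \<le> 1"
  shows "matrix_powr_quot p A B H =
    U ** (\<chi> a b. of_real (powr_quot p (x a) (y b)) * (adjoint_matrix U ** H ** V) $ a $ b) ** adjoint_matrix V"
proof -
  let ?N = "adjoint_matrix U ** H ** V"
  have s: "(\<lambda>k. complex_of_real ((p gchoose k) * pow_quot k (x a - 1) (y b - 1))) sums
      of_real (powr_quot p (x a) (y b))" for a b
    using x[of a] y[of b] by (intro sums_of_real powr_quot_sums) auto
  have "(\<lambda>k. of_real (p gchoose k) * matpow_diff k (A - mat 1) (B - mat 1) H $ i $ j) sums
    (\<Sum>a\<in>UNIV. \<Sum>b\<in>UNIV. U $ i $ a * (of_real (powr_quot p (x a) (y b)) * ?N $ a $ b) * cnj (V $ j $ b))" for i j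
  proof -
    have "(\<lambda>k. \<Sum>a\<in>UNIV. \<Sum>b\<in>UNIV. U $ i $ a * (of_real ((p gchoose k) * pow_quot k (x a - 1) (y b - 1)) * ?N $ a $ b) * cnj (V $ j $ b))
      sums (\<Sum>a\<in>UNIV. \<Sum>b\<in>UNIV. U $ i $ a * (of_real (powr_quot p (x a) (y b)) * ?N $ a $ b) * cnj (V $ j $ b))"
      by (rule sums_sum, rule sums_sum, rule sums_mult2, rule sums_mult, rule sums_mult2, rule s)
    moreover have "of_real (p gchoose k) * matpow_diff k (A - mat 1) (B - mat 1) H $ i $ j =
      (\<Sum>a\<in>UNIV. \<Sum>b\<in>UNIV. U $ i $ a * (of_real ((p gchoose k) * pow_quot k (x a - 1) (y b - 1)) * ?N $ a $ b) * cnj (V $ j $ b))" for k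
      unfolding spectral_minus_one[OF U] spectral_minus_one[OF V] matpow_diff_spectral[OF U(1) V(1)] matrix_conj_entry
      by (simp add: sum_distrib_left mult_ac)
    ultimately show ?thesis by simp
  qed
  then show ?thesis
    by (simp add: matrix_powr_quot_def vec_eq_iff matrix_conj_entry sums_iff)
qed

text \<open>The shifted eigenvalues have modulus at most \<open>1 - m\<close>, which bounds the
  scalar weights. Summing the unitarily invariant entry bound over all index pairs gives the squared
  dimension.\<close>

lemma matpow_diff_entry_le:
  fixes A B :: "complex^'n^'n"
  assumes A: "state A" "\<And>v. norm v = 1 \<Longrightarrow> m \<le> v \<bullet> (A *v v)"
    and B: "state B" "\<And>v. norm v = 1 \<Longrightarrow> m \<le> v \<bullet> (B *v v)" and m: "m \<ge> 0"
  shows "cmod (matpow_diff k (A - mat 1) (B - mat 1) H $ i $ j) \<le>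
    real k * (1 - m) ^ (k - 1) * ((real CARD('n))\<^sup>2 * (\<Sum>a\<in>UNIV. \<Sum>b\<in>UNIV. cmod (H $ a $ b)))"
proof -
  obtain U x where U: "unitary_matrix U" "A = U ** real_diag x ** adjoint_matrix U"
    and x: "\<And>i. m \<le> x i" "\<And>i. x i \<le> 1" using state_spectral[OF A m] by metis
  obtain V y where V: "unitary_matrix V" "B = V ** real_diag y ** adjoint_matrix V"
    and y: "\<And>i. m \<le> y i" "\<And>i. y i \<le> 1" using state_spectral[OF B m] by metis
  let ?S = "\<Sum>a\<in>UNIV. \<Sum>b\<in>UNIV. cmod (H $ a $ b)"
  let ?N = "adjoint_matrix U ** H ** V"
  have N: "cmod (?N $ a $ b) \<le> ?S" for a b
    using unitary_conj_entry_le[OF unitary_matrix_adjoint[OF U(1)] unitary_matrix_adjoint[OF V(1)], of H a b] by simp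
  have q: "\<bar>pow_quot k (x a - 1) (y b - 1)\<bar> \<le> real k * (1 - m) ^ (k - 1)" for a b
    using x y by (intro abs_pow_quot_le) auto
  have "cmod (matpow_diff k (A - mat 1) (B - mat 1) H $ i $ j) \<le>
    (\<Sum>a\<in>UNIV. \<Sum>b\<in>UNIV. \<bar>pow_quot k (x a - 1) (y b - 1)\<bar> * cmod (?N $ a $ b))"
    unfolding spectral_minus_one[OF U] spectral_minus_one[OF V] matpow_diff_spectral[OF U(1) V(1)]
    by (rule order_trans[OF unitary_conj_entry_le[OF U(1) V(1)]]) (simp add: norm_mult)
  also have "\<dots> \<le> (\<Sum>a\<in>(UNIV::'n set). \<Sum>b\<in>(UNIV::'n set). real k * (1 - m) ^ (k - 1) * ?S)"
    using N q order_trans[OF x] by (intro sum_mono mult_mono) auto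
  also have "\<dots> = real k * (1 - m) ^ (k - 1) * ((real CARD('n))\<^sup>2 * ?S)"
    by (simp add: power2_eq_square)
  finally show ?thesis .
qed

text \<open>Joint continuity in both states and the direction, by Tannery's theorem: each term is a
  matrix polynomial, and near the limit all terms are dominated by one summable sequence.
  Differentiability of matrix powers will follow from this alone.\<close>

lemma tendsto_matrix_powr_quot:
  fixes f g h :: "'a \<Rightarrow> complex^'n^'n"
  assumes f: "(f \<longlongrightarrow> A) F" "\<And>x. state (f x)" "pos_def A"
    and g: "(g \<longlongrightarrow> B) F" "\<And>x. state (g x)" "pos_def B"
    and h: "(h \<longlongrightarrow> H) F" and F: "F \<noteq> bot"
  shows "((\<lambda>x. matrix_powr_quot p (f x) (g x) (h x)) \<longlongrightarrow> matrix_powr_quot p A B H) F"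
proof -
  obtain m1 where m1: "m1 > 0" "eventually (\<lambda>x. \<forall>v. norm v = 1 \<longrightarrow> m1 \<le> v \<bullet> (f x *v v)) F"
    using eventually_uniform_lower_bound[OF f(1,3)] by blast
  obtain m2 where m2: "m2 > 0" "eventually (\<lambda>x. \<forall>v. norm v = 1 \<longrightarrow> m2 \<le> v \<bullet> (g x *v v)) F"
    using eventually_uniform_lower_bound[OF g(1,3)] by blast
  \<comment> \<open>A common spectral lower bound near the limit; the cap \<open>1/2\<close> ensures
    that the radius \<open>1 - m\<close> lies in \<open>[0, 1)\<close>.\<close>
  define m where "m = min (min m1 m2) (1/2)"
  have m: "0 < m" "m \<le> m1" "m \<le> m2" "m < 1" using m1 m2 by (auto simp: m_def)
  let ?S = "\<lambda>H. \<Sum>a\<in>UNIV. \<Sum>b\<in>UNIV. cmod (H $ a $ b)"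
  \<comment> \<open>The added \<open>1\<close> leaves room for \<open>h x\<close> to differ from its
    limit \<open>H\<close>.\<close>
  define C where "C = (real CARD('n))\<^sup>2 * (?S H + 1)"
  have "((\<lambda>x. ?S (h x)) \<longlongrightarrow> ?S H) F" by (intro tendsto_intros h)
  then have "eventually (\<lambda>x. ?S (h x) < ?S H + 1) F" by (rule order_tendstoD) simp
  then have ev: "eventually (\<lambda>x. \<forall>k i j. cmod (of_real (p gchoose k) * matpow_diff k (f x - mat 1) (g x - mat 1) (h x) $ i $ j) \<le>
      \<bar>p gchoose k\<bar> * (real k * (1 - m) ^ (k - 1)) * C) F"
    using m1(2) m2(2)
  proof eventually_elim
    case (elim x)
    show ?case
    proof (intro allI)
      fix k i j
      have "cmod (matpow_diff k (f x - mat 1) (g x - mat 1) (h x) $ i $ j) \<le>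
        real k * (1 - m) ^ (k - 1) * ((real CARD('n))\<^sup>2 * ?S (h x))"
        using elim m f(2) g(2) by (intro matpow_diff_entry_le) (auto intro: order_trans)
      also have "\<dots> \<le> real k * (1 - m) ^ (k - 1) * C"
        unfolding C_def using elim m by (intro mult_left_mono) auto
      finally show "cmod (of_real (p gchoose k) * matpow_diff k (f x - mat 1) (g x - mat 1) (h x) $ i $ j) \<le>
        \<bar>p gchoose k\<bar> * (real k * (1 - m) ^ (k - 1)) * C"
        by (simp add: norm_mult mult_left_mono mult.assoc)
    qed
  qed
  have "((\<lambda>x. \<Sum>k. of_real (p gchoose k) * matpow_diff k (f x - mat 1) (g x - mat 1) (h x) $ i $ j) \<longlongrightarrow>
    (\<Sum>k. of_real (p gchoose k) * matpow_diff k (A - mat 1) (B - mat 1) H $ i $ j)) F" for i j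
  proof (rule tannerys_theorem[THEN conjunct2, THEN conjunct2])
    show "((\<lambda>x. of_real (p gchoose k) * matpow_diff k (f x - mat 1) (g x - mat 1) (h x) $ i $ j) \<longlongrightarrow>
      of_real (p gchoose k) * matpow_diff k (A - mat 1) (B - mat 1) H $ i $ j) F" for k
      by (intro tendsto_intros f g h)
    show "eventually (\<lambda>(k, x). norm (of_real (p gchoose k) * matpow_diff k (f x - mat 1) (g x - mat 1) (h x) $ i $ j) \<le>
      \<bar>p gchoose k\<bar> * (real k * (1 - m) ^ (k - 1)) * C) (at_top \<times>\<^sub>F F)"
      unfolding eventually_prod_filter
      by (rule exI[of _ "\<lambda>_. True"], rule exI, intro conjI, simp, rule ev) simp
    show "summable (\<lambda>k. \<bar>p gchoose k\<bar> * (real k * (1 - m) ^ (k - 1)) * C)"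
      using m by (intro summable_mult2 summable_abs_gbinomial_deriv) auto
    show "F \<noteq> bot" by fact
  qed
  then show ?thesis
    unfolding matrix_powr_quot_def by (intro vec_tendstoI) simp
qed

section \<open>Matrix powers and traces in an eigenbasis\<close>

lemma matrix_powr_spectral:
  assumes "unitary_matrix U" "A = U ** real_diag d ** adjoint_matrix U"
  shows "matrix_powr A p = U ** real_diag (\<lambda>i. d i powr p) ** adjoint_matrix U"
  using matrix_fun_eq[OF assms, of "\<lambda>x. x powr p"] by (simp add: matrix_powr_def o_def)

lemma scaleR_matrix_mult_left: "(c *\<^sub>R A) ** B = c *\<^sub>R (A ** B)" for A :: "complex^'n^'m"
  by (simp add: matrix_matrix_mult_def vec_eq_iff scaleR_sum_right)

lemma scaleR_matrix_mult_right: "A ** (c *\<^sub>R B) = c *\<^sub>R (A ** B)" for A :: "complex^'n^'m"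
  by (simp add: matrix_matrix_mult_def vec_eq_iff scaleR_sum_right)

text \<open>In the mixed eigenbases \<open>A - B\<close> has entries
  \<open>(x a - y b) * W $ a $ b\<close>, and the weight turns \<open>x a - y b\<close> into the
  difference of powers. The scalar \<open>c\<close> is carried along to serve as the
  \<open>1 / t\<close> of a difference quotient.\<close>

lemma matrix_powr_quot_diff:
  assumes A: "state A" "pos_def A" and B: "state B" "pos_def B"
  shows "matrix_powr_quot p A B (c *\<^sub>R (A - B)) = c *\<^sub>R (matrix_powr A p - matrix_powr B p)"
proof -
  obtain U x where U: "unitary_matrix U" "A = U ** real_diag x ** adjoint_matrix U"
    and x: "\<And>i. 0 < x i" "\<And>i. x i \<le> 1" using pos_def_state_spectral[OF A] by metis
  obtain V y where V: "unitary_matrix V" "B = V ** real_diag y ** adjoint_matrix V"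
    and y: "\<And>i. 0 < y i" "\<And>i. y i \<le> 1" using pos_def_state_spectral[OF B] by metis
  define W where "W = adjoint_matrix U ** V"
  have 1: "U ** real_diag e ** adjoint_matrix U = U ** (real_diag e ** W) ** adjoint_matrix V" for e
    unfolding W_def using V(1) by (simp add: unitary_matrix_def flip: matrix_mul_assoc)
  have 2: "V ** real_diag e ** adjoint_matrix V = U ** (W ** real_diag e) ** adjoint_matrix V" for e
    unfolding W_def using U(1) by (simp add: unitary_cancel_left flip: matrix_mul_assoc)
  have 3: "adjoint_matrix U ** (U ** M ** adjoint_matrix V) ** V = M" for M
    using U(1) V(1) by (simp add: unitary_cancel_left unitary_matrix_def flip: matrix_mul_assoc)
  have 4: "U ** M ** adjoint_matrix V - U ** N ** adjoint_matrix V = U ** (M - N) ** adjoint_matrix V" for M N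
    by (simp add: vec_eq_iff matrix_conj_entry algebra_simps sum_subtractf)
  have AB: "A - B = U ** (real_diag x ** W - W ** real_diag y) ** adjoint_matrix V"
    unfolding U(2) V(2) 1 2 4 ..
  have PAB: "matrix_powr A p - matrix_powr B p =
    U ** (real_diag (\<lambda>i. x i powr p) ** W - W ** real_diag (\<lambda>i. y i powr p)) ** adjoint_matrix V"
    unfolding matrix_powr_spectral[OF U] matrix_powr_spectral[OF V] 1 2 4 ..
  have "of_real (powr_quot p (x a) (y b)) * (of_real (x a) * W $ a $ b - W $ a $ b * of_real (y b)) =
     of_real (x a powr p) * W $ a $ b - W $ a $ b * of_real (y b powr p)" for a b
  proof -
    have "of_real (powr_quot p (x a) (y b)) * (of_real (x a) * W $ a $ b - W $ a $ b * of_real (y b)) =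
      of_real (powr_quot p (x a) (y b) * (x a - y b)) * W $ a $ b"
      by (simp add: algebra_simps)
    then show ?thesis unfolding powr_quot_mult by (simp add: algebra_simps)
  qed
  then have "(\<chi> a b. of_real (powr_quot p (x a) (y b)) * (c *\<^sub>R (real_diag x ** W - W ** real_diag y)) $ a $ b) =
    c *\<^sub>R (real_diag (\<lambda>i. x i powr p) ** W - W ** real_diag (\<lambda>i. y i powr p))"
    by (simp add: vec_eq_iff matrix_mult_real_diag real_diag_mult_matrix)
  then show ?thesis
    unfolding matrix_powr_quot_spectral[OF U V x y] AB PAB
    by (simp add: scaleR_matrix_mult_left scaleR_matrix_mult_right 3)
qed

text \<open>Against a function of \<open>A\<close> only the diagonal weights
  \<open>p * x powr (p - 1)\<close> survive in the trace, and \<open>x powr (1 - p)\<close> cancels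
  their power. For traceless \<open>H\<close> the result is zero.\<close>

lemma trace_powr_mult_quot:
  assumes A: "state A" "pos_def A"
  shows "trace (matrix_powr A (1 - p) ** matrix_powr_quot p A A H) = of_real p * trace H"
proof -
  obtain U x where U: "unitary_matrix U" "A = U ** real_diag x ** adjoint_matrix U"
    and x: "\<And>i. 0 < x i" "\<And>i. x i \<le> 1" using pos_def_state_spectral[OF A] by metis
  let ?N = "adjoint_matrix U ** H ** U"
  let ?M = "\<chi> a b. of_real (powr_quot p (x a) (x b)) * ?N $ a $ b"
  have "matrix_powr A (1 - p) ** matrix_powr_quot p A A H = U ** (real_diag (\<lambda>i. x i powr (1 - p)) ** ?M) ** adjoint_matrix U"
    unfolding matrix_powr_spectral[OF U] matrix_powr_quot_spectral[OF U U x x]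
    using U(1) by (simp add: unitary_cancel_left flip: matrix_mul_assoc)
  then have "trace (matrix_powr A (1 - p) ** matrix_powr_quot p A A H) = trace (real_diag (\<lambda>i. x i powr (1 - p)) ** ?M)"
    using trace_unitary_conj[OF U(1)] by simp
  also have "\<dots> = (\<Sum>a\<in>UNIV. of_real (x a powr (1 - p) * powr_quot p (x a) (x a)) * ?N $ a $ a)"
    by (simp add: trace_def real_diag_mult_matrix mult.assoc)
  also have "\<dots> = (\<Sum>a\<in>UNIV. of_real p * ?N $ a $ a)"
  proof (intro sum.cong refl)
    fix a
    have "x a powr (1 - p) * x a powr (p - 1) = 1"
      using x(1)[of a] by (simp flip: powr_add)
    then show "of_real (x a powr (1 - p) * powr_quot p (x a) (x a)) * ?N $ a $ a = of_real p * ?N $ a $ a"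
      by (simp add: powr_quot_def mult.left_commute)
  qed
  also have "\<dots> = of_real p * trace ?N" by (simp add: trace_def sum_distrib_left)
  also have "trace ?N = trace H"
    using trace_unitary_conj[OF unitary_matrix_adjoint[OF U(1)], of H] by simp
  finally show ?thesis .
qed

lemma trace_quot_mult_quot:
  assumes U: "unitary_matrix U" "A = U ** real_diag x ** adjoint_matrix U"
    and x: "\<And>i. 0 < x i" "\<And>i. x i \<le> 1"
  shows "trace (matrix_powr_quot p A A H ** matrix_powr_quot q A A K) =
    (\<Sum>a\<in>UNIV. \<Sum>b\<in>UNIV. of_real (powr_quot p (x a) (x b) * powr_quot q (x a) (x b)) *
      ((adjoint_matrix U ** H ** U) $ a $ b * (adjoint_matrix U ** K ** U) $ b $ a))"
proof -
  let ?M = "\<lambda>p H. \<chi> a b. of_real (powr_quot p (x a) (x b)) * (adjoint_matrix U ** H ** U) $ a $ b"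
  have "matrix_powr_quot p A A H ** matrix_powr_quot q A A K = U ** (?M p H ** ?M q K) ** adjoint_matrix U"
    unfolding matrix_powr_quot_spectral[OF U U x x]
    using U(1) by (simp add: unitary_cancel_left flip: matrix_mul_assoc)
  then have "trace (matrix_powr_quot p A A H ** matrix_powr_quot q A A K) = trace (?M p H ** ?M q K)"
    using trace_unitary_conj[OF U(1)] by simp
  also have "\<dots> = (\<Sum>a\<in>UNIV. \<Sum>b\<in>UNIV. of_real (powr_quot p (x a) (x b) * powr_quot q (x a) (x b)) *
      ((adjoint_matrix U ** H ** U) $ a $ b * (adjoint_matrix U ** K ** U) $ b $ a))"
    by (simp add: trace_def matrix_matrix_mult_def powr_quot_commute[of q] mult_ac)
  finally show ?thesis .
qed

subsection \<open>The kernel\<close>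

text \<open>Termwise in the power series of \<open>cosh\<close>: dividing
  \<open>1 - v ^ (2 * k)\<close> by \<open>1 - v ^ 2\<close> leaves the geometric sum of the powers
  of \<open>v ^ 2\<close> below \<open>k\<close>, which increases with \<open>v\<close>. The
  argument works on both sides of \<open>v = 1\<close> and across it.\<close>

lemma cosh_secant_mono:
  fixes t u w :: real
  assumes "0 \<le> u" "u \<le> w" "u \<noteq> 1" "w \<noteq> 1"
  shows "(cosh t - cosh (u * t)) / (1 - u\<^sup>2) \<le> (cosh t - cosh (w * t)) / (1 - w\<^sup>2)"
proof -
  define c where "c v k = (\<Sum>i<k. v ^ i) * t ^ (2 * k) / fact (2 * k)" for v :: real and k
  have series: "(\<lambda>n. if even n then c (v\<^sup>2) (n div 2) else 0) sums ((cosh t - cosh (v * t)) / (1 - v\<^sup>2))"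
    if v: "0 \<le> v" "v \<noteq> 1" for v
  proof -
    have v2: "v\<^sup>2 \<noteq> 1" using v by (simp add: power2_eq_1_iff)
    have "(\<lambda>n. ((if even n then t ^ n /\<^sub>R fact n else 0) - (if even n then (v * t) ^ n /\<^sub>R fact n else 0)) / (1 - v\<^sup>2))
        sums ((cosh t - cosh (v * t)) / (1 - v\<^sup>2))"
      by (intro sums_divide sums_diff cosh_converges)
    moreover have "((if even n then t ^ n /\<^sub>R fact n else 0) - (if even n then (v * t) ^ n /\<^sub>R fact n else 0)) / (1 - v\<^sup>2)
        = (if even n then c (v\<^sup>2) (n div 2) else 0)" for n
    proof (cases "even n")
      case True
      then obtain k where n: "n = 2 * k" by (elim evenE)
      have "t ^ n / fact n - (v * t) ^ n / fact n = (1 - (v\<^sup>2) ^ k) * (t ^ n / fact n)"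
        by (simp add: n power_mult_distrib power_mult left_diff_distrib diff_divide_distrib)
      then show ?thesis
        using True v2 by (simp add: c_def n sum_gp_strict divide_inverse_commute)
    qed simp
    ultimately show ?thesis by simp
  qed
  have "c (u\<^sup>2) k \<le> c (w\<^sup>2) k" for k
    unfolding c_def using assms
    by (intro divide_right_mono mult_right_mono sum_mono power_mono) auto
  then show ?thesis
    using assms by (intro sums_le[OF _ series series]) auto
qed

definition petz_kernel :: "real \<Rightarrow> real \<Rightarrow> real \<Rightarrow> real" where
  "petz_kernel \<alpha> x y = powr_quot \<alpha> x y * powr_quot (1 - \<alpha>) x y / (\<alpha> * (1 - \<alpha>))"

lemma petz_kernel_flip: "petz_kernel (1 - \<alpha>) x y = petz_kernel \<alpha> x y"
  by (simp add: petz_kernel_def mult.commute)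

lemma petz_kernel_same:
  assumes "x > 0" "\<alpha> \<noteq> 0" "\<alpha> \<noteq> 1"
  shows "petz_kernel \<alpha> x x = 1 / x"
proof -
  have "x powr (\<alpha> - 1) * x powr (- \<alpha>) = x powr (- 1)"
    by (simp flip: powr_add)
  also have "\<dots> = 1 / x" using assms(1) by (subst powr_minus_divide) simp
  finally have "x powr (\<alpha> - 1) * x powr (- \<alpha>) = 1 / x" .
  then show ?thesis using assms by (simp add: petz_kernel_def powr_quot_def)
qed

text \<open>With \<open>x = exp (s + t)\<close> and \<open>y = exp (s - t)\<close> the product of
  the two differences of powers expands to
  \<open>2 * exp s * (cosh t - cosh ((2 * \<alpha> - 1) * t))\<close>.\<close>

lemma petz_kernel_cosh:
  assumes "x > 0" "y > 0" "x \<noteq> y"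
  shows "petz_kernel \<alpha> x y = 8 * sqrt (x * y) / (x - y)\<^sup>2 *
    ((cosh ((ln x - ln y) / 2) - cosh ((2 * \<alpha> - 1) * ((ln x - ln y) / 2))) / (1 - (2 * \<alpha> - 1)\<^sup>2))"
proof -
  define s t where "s = (ln x + ln y) / 2" and "t = (ln x - ln y) / 2"
  have "s + t = ln x" "s - t = ln y" by (simp_all add: s_def t_def field_simps)
  then have x: "x = exp (s + t)" and y: "y = exp (s - t)" using assms by simp_all
  have "sqrt (x * y) = exp s"
  proof (rule real_sqrt_unique)
    show "(exp s)\<^sup>2 = x * y" by (simp add: x y power2_eq_square flip: exp_add)
  qed simp
  moreover have "(x powr \<alpha> - y powr \<alpha>) * (x powr (1 - \<alpha>) - y powr (1 - \<alpha>)) =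
      2 * exp s * (cosh t - cosh ((2 * \<alpha> - 1) * t))"
    by (simp add: x y powr_def cosh_def algebra_simps flip: exp_add)
  moreover have "1 - (2 * \<alpha> - 1)\<^sup>2 = 4 * (\<alpha> * (1 - \<alpha>))"
    by (simp add: power2_eq_square algebra_simps)
  moreover have "petz_kernel \<alpha> x y =
      (x powr \<alpha> - y powr \<alpha>) * (x powr (1 - \<alpha>) - y powr (1 - \<alpha>)) / ((x - y)\<^sup>2 * (\<alpha> * (1 - \<alpha>)))"
    using assms(3) by (simp add: petz_kernel_def powr_quot_def power2_eq_square)
  moreover have "2 * e * c / (d * a) = 8 * e / d * (c / (4 * a))" for e c d a :: real
    by (simp add: mult_ac)
  ultimately show ?thesis
    unfolding t_def[symmetric] by metis
qed

lemma petz_kernel_mono: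
  assumes "x > 0" "y > 0" "1/2 \<le> \<alpha>" "\<alpha> \<le> \<beta>" "\<alpha> \<noteq> 1" "\<beta> \<noteq> 1"
  shows "petz_kernel \<alpha> x y \<le> petz_kernel \<beta> x y"
proof (cases "x = y")
  case True
  then show ?thesis using assms by (simp add: petz_kernel_same)
next
  case False
  show ?thesis
    unfolding petz_kernel_cosh[OF assms(1,2) False] using assms
    by (intro mult_left_mono cosh_secant_mono) auto
qed

text \<open>For \<open>x \<noteq> y\<close> the singular factor \<open>1 / (1 - \<alpha>)\<close> is
  absorbed: \<open>?g\<close> vanishes at \<open>\<alpha> = 1\<close>, so together they form a
  difference quotient tending to a derivative. For \<open>x = y\<close> the kernel is constant near
  \<open>1\<close>.\<close>

lemma petz_kernel_convergent:
  assumes "x > 0" "y > 0"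
  shows "\<exists>l. ((\<lambda>\<alpha>. petz_kernel \<alpha> x y) \<longlongrightarrow> l) (at 1)"
proof (cases "x = y")
  case True
  have "eventually (\<lambda>\<alpha>::real. \<alpha> \<in> {0<..} - {1}) (at 1)"
    by (intro eventually_at_in_open) auto
  then have "eventually (\<lambda>\<alpha>. petz_kernel \<alpha> x y = 1 / x) (at 1)"
    by eventually_elim (use True assms petz_kernel_same in auto)
  then show ?thesis by (intro exI) (rule tendsto_eventually)
next
  case False
  let ?g = "\<lambda>\<alpha>. x powr (1 - \<alpha>) - y powr (1 - \<alpha>)"
  have "(?g has_real_derivative (ln y - ln x)) (at 1)"
    using assms by (auto intro!: derivative_eq_intros)
  then have "((\<lambda>\<alpha>. (?g \<alpha> - ?g 1) / (\<alpha> - 1)) \<longlongrightarrow> ln y - ln x) (at 1)"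
    by (simp add: has_field_derivative_iff)
  then have "((\<lambda>\<alpha>. - (powr_quot \<alpha> x y / \<alpha> / (x - y)) * ((?g \<alpha> - ?g 1) / (\<alpha> - 1))) \<longlongrightarrow>
      - ((x powr 1 - y powr 1) / (x - y) / 1 / (x - y)) * (ln y - ln x)) (at 1)"
    using assms False by (simp only: powr_quot_def if_False) (intro tendsto_intros; simp)
  moreover have "- (powr_quot \<alpha> x y / \<alpha> / (x - y)) * ((?g \<alpha> - ?g 1) / (\<alpha> - 1)) = petz_kernel \<alpha> x y" for \<alpha>
  proof -
    have "- (q / a / c) * (g / - b) = q * (g / c) / (a * b)" for q a c g b :: real
      by (simp add: mult_ac)
    from this[of "powr_quot \<alpha> x y" \<alpha> "x - y" "?g \<alpha>" "1 - \<alpha>"] show ?thesis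
      using False assms by (simp add: petz_kernel_def powr_quot_def[of "1 - \<alpha>"])
  qed
  ultimately show ?thesis by auto
qed

subsection \<open>The Hessian\<close>

lemma has_vector_derivative_zero_limit:
  fixes f :: "real \<Rightarrow> 'b::real_normed_vector"
  assumes "(f has_vector_derivative D) (at 0)"
  shows "((\<lambda>t. (1 / t) *\<^sub>R (f t - f 0)) \<longlongrightarrow> D) (at 0)"
proof -
  have "((\<lambda>t. norm (f t - f 0 - t *\<^sub>R D) / \<bar>t\<bar>) \<longlongrightarrow> 0) (at 0)"
    using assms by (simp add: has_vector_derivative_def has_derivative_at)
  then have "((\<lambda>t. norm ((1 / t) *\<^sub>R (f t - f 0) - D)) \<longlongrightarrow> 0) (at 0)"
  proof (rule Lim_transform_eventually)
    have "eventually (\<lambda>t::real. t \<noteq> 0) (at 0)" by (rule eventually_neq_at_within)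
    then show "eventually (\<lambda>t. norm (f t - f 0 - t *\<^sub>R D) / \<bar>t\<bar> = norm ((1 / t) *\<^sub>R (f t - f 0) - D)) (at 0)"
    proof eventually_elim
      case (elim t)
      then have "(1 / t) *\<^sub>R (f t - f 0) - D = (1 / t) *\<^sub>R (f t - f 0 - t *\<^sub>R D)"
        by (simp add: scaleR_diff_right)
      then show ?case by simp
    qed
  qed
  then show ?thesis by (rule LIM_zero_cancel[OF tendsto_norm_zero_cancel])
qed

lemma tendsto_trace [tendsto_intros]:
  fixes f :: "'a \<Rightarrow> complex^'n^'n"
  shows "(f \<longlongrightarrow> A) F \<Longrightarrow> ((\<lambda>x. trace (f x)) \<longlongrightarrow> trace A) F"
  unfolding trace_def by (intro tendsto_intros)

lemma trace_scaleR: "trace (c *\<^sub>R A) = c *\<^sub>R trace A" for A :: "complex^'n^'n"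
  by (simp add: trace_def scaleR_sum_right)

lemma bounded_linear_trace: "bounded_linear (trace :: complex^'n^'n \<Rightarrow> complex)"
  unfolding linear_conv_bounded_linear[symmetric]
  by (rule linearI) (simp_all add: trace_add trace_scaleR)

lemma bounded_linear_adjoint_matrix: "bounded_linear (adjoint_matrix :: complex^'n^'n \<Rightarrow> complex^'n^'n)"
  unfolding linear_conv_bounded_linear[symmetric]
  by (rule linearI) (simp_all add: adjoint_matrix_def vec_eq_iff)

section \<open>Differentiable families of states\<close>

locale state_family =
  fixes \<rho> :: "real^'l \<Rightarrow> complex^'n^'n" and \<rho>' :: "real^'l \<Rightarrow> (real^'l) \<Rightarrow>\<^sub>L (complex^'n^'n)"
  assumes state: "\<And>x. state (\<rho> x)" and pos_def: "\<And>x. pos_def (\<rho> x)"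
    and deriv: "\<And>x. (\<rho> has_derivative blinfun_apply (\<rho>' x)) (at x)"
    and deriv_differentiable: "\<And>x. \<rho>' differentiable (at x)"
begin

lemma trace_deriv: "trace (\<rho>' x v) = 0"
proof -
  have "((\<lambda>x. trace (\<rho> x)) has_derivative (\<lambda>v. trace (\<rho>' x v))) (at x)"
    by (rule bounded_linear.has_derivative[OF bounded_linear_trace deriv])
  moreover have "((\<lambda>x. trace (\<rho> x)) has_derivative (\<lambda>v. 0)) (at x)"
    using state by (simp add: state_def)
  ultimately show ?thesis by (metis has_derivative_unique)
qed

lemma hermitian_deriv: "adjoint_matrix (\<rho>' x v) = \<rho>' x v"
proof -
  have "((\<lambda>x. adjoint_matrix (\<rho> x)) has_derivative (\<lambda>v. adjoint_matrix (\<rho>' x v))) (at x)"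
    by (rule bounded_linear.has_derivative[OF bounded_linear_adjoint_matrix deriv])
  moreover have "(\<lambda>x. adjoint_matrix (\<rho> x)) = \<rho>"
    using state by (auto simp: state_def pos_semidef_def hermitian_matrix_def)
  ultimately show ?thesis using has_derivative_unique[OF _ deriv] by metis
qed

lemma tendsto_line: fixes x v :: "real^'l" shows "((\<lambda>t. x + t *\<^sub>R v) \<longlongrightarrow> x) (at (0::real))"
proof -
  have "((\<lambda>t::real. x + t *\<^sub>R v) \<longlongrightarrow> x + 0 *\<^sub>R v) (at (0::real))" by (intro tendsto_intros)
  then show ?thesis by simp
qed

lemma tendsto_state_line: "((\<lambda>t. \<rho> (x + t *\<^sub>R v)) \<longlongrightarrow> \<rho> x) (at (0::real))"
proof -
  have "isCont \<rho> x" using deriv has_derivative_continuous by blast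
  then show ?thesis using isCont_tendsto_compose tendsto_line by blast
qed

lemma tendsto_deriv_line: "((\<lambda>t. \<rho>' (x + t *\<^sub>R v) w) \<longlongrightarrow> \<rho>' x w) (at (0::real))"
proof -
  have "isCont \<rho>' x" using deriv_differentiable differentiable_imp_continuous_within by blast
  then have "((\<lambda>t. \<rho>' (x + t *\<^sub>R v)) \<longlongrightarrow> \<rho>' x) (at 0)"
    using isCont_tendsto_compose tendsto_line by blast
  then show ?thesis by (intro tendsto_intros)
qed

lemma state_line_limit:
  "((\<lambda>t. (1 / t) *\<^sub>R (\<rho> (x + t *\<^sub>R v) - \<rho> x)) \<longlongrightarrow> \<rho>' x v) (at 0)"
proof -
  have "((\<lambda>t. \<rho> (x + t *\<^sub>R v)) has_derivative (\<lambda>t. \<rho>' (x + 0 *\<^sub>R v) (t *\<^sub>R v))) (at 0)"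
    by (rule has_derivative_compose[OF _ deriv]) (auto intro!: derivative_eq_intros)
  then have "((\<lambda>t. \<rho> (x + t *\<^sub>R v)) has_vector_derivative \<rho>' x v) (at 0)"
    by (simp add: has_vector_derivative_def blinfun.scaleR_right)
  from has_vector_derivative_zero_limit[OF this] show ?thesis by simp
qed

text \<open>The difference quotient of the powers is the divided difference at
  \<open>\<rho> (x + t *\<^sub>R v)\<close> and \<open>\<rho> x\<close>, applied to the difference
  quotient of \<open>\<rho>\<close>. Joint continuity then gives the limit without any perturbation
  theory of eigenvectors.\<close>

lemma matrix_powr_line_limit:
  "((\<lambda>t. (1 / t) *\<^sub>R (matrix_powr (\<rho> (x + t *\<^sub>R v)) p - matrix_powr (\<rho> x) p)) \<longlongrightarrow>
    matrix_powr_quot p (\<rho> x) (\<rho> x) (\<rho>' x v)) (at 0)"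
proof -
  have "((\<lambda>t. matrix_powr_quot p (\<rho> (x + t *\<^sub>R v)) (\<rho> x) ((1 / t) *\<^sub>R (\<rho> (x + t *\<^sub>R v) - \<rho> x))) \<longlongrightarrow>
    matrix_powr_quot p (\<rho> x) (\<rho> x) (\<rho>' x v)) (at 0)"
    by (intro tendsto_matrix_powr_quot tendsto_state_line state_line_limit tendsto_const state pos_def) simp
  then show ?thesis by (simp add: matrix_powr_quot_diff state pos_def)
qed

lemma matrix_powr_quot_line_limit:
  "((\<lambda>t. matrix_powr_quot p (\<rho> (x + t *\<^sub>R v)) (\<rho> (x + t *\<^sub>R v)) (\<rho>' (x + t *\<^sub>R v) w)) \<longlongrightarrow>
    matrix_powr_quot p (\<rho> x) (\<rho> x) (\<rho>' x w)) (at 0)"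
  by (intro tendsto_matrix_powr_quot tendsto_state_line tendsto_deriv_line state pos_def) simp

lemma trace_powr_line_derivative:
  "((\<lambda>t. Re (trace (P ** matrix_powr (\<rho> (x + t *\<^sub>R v)) p))) has_real_derivative
    Re (trace (P ** matrix_powr_quot p (\<rho> x) (\<rho> x) (\<rho>' x v)))) (at 0)"
proof -
  have "((\<lambda>t. Re (trace (P ** ((1 / t) *\<^sub>R (matrix_powr (\<rho> (x + t *\<^sub>R v)) p - matrix_powr (\<rho> x) p))))) \<longlongrightarrow>
    Re (trace (P ** matrix_powr_quot p (\<rho> x) (\<rho> x) (\<rho>' x v)))) (at 0)"
    by (intro tendsto_intros matrix_powr_line_limit)
  moreover have "Re (trace (P ** ((1 / t) *\<^sub>R (M - N)))) = (Re (trace (P ** M)) - Re (trace (P ** N))) / t" for t M N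
  proof -
    have "P ** (M - N) = P ** M - P ** N"
      by (simp add: matrix_matrix_mult_def vec_eq_iff algebra_simps sum_subtractf)
    then show ?thesis by (simp add: scaleR_matrix_mult_right trace_scaleR trace_sub)
  qed
  ultimately show ?thesis by (simp add: DERIV_def)
qed

lemma trace_matrix_powr_mult:
  "trace (matrix_powr (\<rho> x) p ** matrix_powr (\<rho> x) (1 - p)) = 1"
proof -
  obtain U d where U: "unitary_matrix U" "\<rho> x = U ** real_diag d ** adjoint_matrix U"
    and d: "\<And>i. 0 < d i" using pos_def_state_spectral[OF state pos_def] by metis
  have "d i powr p * d i powr (1 - p) = d i" for i
    using d[of i] by (simp flip: powr_add)
  then have "matrix_powr (\<rho> x) p ** matrix_powr (\<rho> x) (1 - p) = \<rho> x"
    unfolding matrix_powr_spectral[OF U] using U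
    by (simp add: real_diag_mult unitary_cancel_left matrix_mul_assoc[of "real_diag _" "real_diag _"]
        flip: matrix_mul_assoc[of U] matrix_mul_assoc[of "adjoint_matrix U"] matrix_mul_assoc[of _ U] matrix_mul_assoc[of _ "adjoint_matrix U"])
  then show ?thesis using state[of x] by (simp add: state_def)
qed

text \<open>Chain rule through the logarithm. Positivity of the trace is a premise here; near
  \<open>\<epsilon> = 0\<close> it comes from continuity, the value at \<open>0\<close> being
  \<open>1\<close>.\<close>

lemma petz_renyi_divergence_derivative:
  assumes "Re (trace (matrix_powr (\<rho> \<theta>) \<alpha> ** matrix_powr (\<rho> (\<theta> + \<epsilon>)) (1 - \<alpha>))) > 0"
  shows "partial_deriv j (\<lambda>\<epsilon>. petz_renyi_divergence \<alpha> (\<rho> \<theta>) (\<rho> (\<theta> + \<epsilon>))) \<epsilon> =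
    1 / (\<alpha> - 1) *
    (Re (trace (matrix_powr (\<rho> \<theta>) \<alpha> ** matrix_powr_quot (1 - \<alpha>) (\<rho> (\<theta> + \<epsilon>)) (\<rho> (\<theta> + \<epsilon>)) (\<rho>' (\<theta> + \<epsilon>) (axis j 1)))) /
     Re (trace (matrix_powr (\<rho> \<theta>) \<alpha> ** matrix_powr (\<rho> (\<theta> + \<epsilon>)) (1 - \<alpha>))))"
  unfolding partial_deriv_def petz_renyi_divergence_def
proof (rule DERIV_imp_deriv, rule DERIV_cmult)
  show "((\<lambda>t. ln (Re (trace (matrix_powr (\<rho> \<theta>) \<alpha> ** matrix_powr (\<rho> (\<theta> + (\<epsilon> + t *\<^sub>R axis j 1))) (1 - \<alpha>))))) has_real_derivative
    (Re (trace (matrix_powr (\<rho> \<theta>) \<alpha> ** matrix_powr_quot (1 - \<alpha>) (\<rho> (\<theta> + \<epsilon>)) (\<rho> (\<theta> + \<epsilon>)) (\<rho>' (\<theta> + \<epsilon>) (axis j 1)))) /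
     Re (trace (matrix_powr (\<rho> \<theta>) \<alpha> ** matrix_powr (\<rho> (\<theta> + \<epsilon>)) (1 - \<alpha>))))) (at 0)"
    using DERIV_chain2[OF DERIV_ln_divide trace_powr_line_derivative[of "matrix_powr (\<rho> \<theta>) \<alpha>" "\<theta> + \<epsilon>" "axis j 1" "1 - \<alpha>"]] assms
    by (simp add: add.assoc)
qed

lemma petz_renyi_hessian_entry:
  assumes "\<alpha> \<noteq> 1"
  shows "petz_renyi_hessian \<rho> \<theta> \<alpha> $ i $ j = 1 / (\<alpha> * (1 - \<alpha>)) *
    Re (trace (matrix_powr_quot \<alpha> (\<rho> \<theta>) (\<rho> \<theta>) (\<rho>' \<theta> (axis i 1)) **
      matrix_powr_quot (1 - \<alpha>) (\<rho> \<theta>) (\<rho> \<theta>) (\<rho>' \<theta> (axis j 1))))"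
proof -
  let ?P = "matrix_powr (\<rho> \<theta>) \<alpha>"
  define Z where "Z t = \<theta> + t *\<^sub>R axis i 1" for t :: real
  define K where "K t = matrix_powr_quot (1 - \<alpha>) (\<rho> (Z t)) (\<rho> (Z t)) (\<rho>' (Z t) (axis j 1))" for t
  define Q where "Q t = Re (trace (?P ** matrix_powr (\<rho> (Z t)) (1 - \<alpha>)))" for t
  define T where "T = Re (trace (matrix_powr_quot \<alpha> (\<rho> \<theta>) (\<rho> \<theta>) (\<rho>' \<theta> (axis i 1)) ** K 0))"
  have Z0: "Z 0 = \<theta>" by (simp add: Z_def)
  have Q0: "Q 0 = 1" by (simp add: Q_def Z0 trace_matrix_powr_mult)
  \<comment> \<open>The key cancellation, valid at every point of the line. It allows
    \<open>?P\<close> to be replaced by \<open>?P - matrix_powr (\<rho> (Z t)) \<alpha>\<close> in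
    front of \<open>K t\<close>, so that dividing by \<open>t\<close> differentiates only the power
    and \<open>K\<close> need only be continuous.\<close>
  have trK: "trace (matrix_powr (\<rho> (Z t)) \<alpha> ** K t) = 0" for t
    using trace_powr_mult_quot[OF state pos_def, of "Z t" "1 - \<alpha>" "\<rho>' (Z t) (axis j 1)"]
    by (simp add: K_def trace_deriv)
  have Qlim: "(Q \<longlongrightarrow> 1) (at 0)"
    using DERIV_isCont[OF trace_powr_line_derivative[of ?P \<theta> "axis i 1" "1 - \<alpha>"]] Q0
    by (simp add: Q_def[abs_def] Z_def isCont_def)
  have Klim: "(K \<longlongrightarrow> K 0) (at 0)"
    using matrix_powr_quot_line_limit by (simp add: K_def[abs_def] Z_def)
  define h where "h t = partial_deriv j (\<lambda>\<epsilon>. petz_renyi_divergence \<alpha> (\<rho> \<theta>) (\<rho> (\<theta> + \<epsilon>))) (t *\<^sub>R axis i 1)" for t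
  have h: "h t = 1 / (\<alpha> - 1) * (Re (trace (?P ** K t)) / Q t)" if "Q t > 0" for t
    using petz_renyi_divergence_derivative[of \<theta> \<alpha> "t *\<^sub>R axis i 1" j] that by (simp add: h_def Q_def K_def Z_def)
  have h0: "h 0 = 0" using h[of 0] Q0 trK[of 0] by (simp add: Z0)
  have "((\<lambda>t. 1 / (1 - \<alpha>) * (Re (trace (((1 / t) *\<^sub>R (matrix_powr (\<rho> (Z t)) \<alpha> - ?P)) ** K t)) / Q t)) \<longlongrightarrow>
      1 / (1 - \<alpha>) * (T / 1)) (at 0)"
    unfolding T_def Z_def by (intro tendsto_intros matrix_powr_line_limit Klim Qlim) simp
  \<comment> \<open>Since \<open>Q\<close> tends to \<open>1\<close> it is positive near
    \<open>0\<close>, where the formula for \<open>h\<close> is available; \<open>h 0 = 0\<close> is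
    the vanishing gradient.\<close>
  moreover have "eventually (\<lambda>t. 1 / (1 - \<alpha>) * (Re (trace (((1 / t) *\<^sub>R (matrix_powr (\<rho> (Z t)) \<alpha> - ?P)) ** K t)) / Q t) =
      (h t - h 0) / t) (at 0)"
    using order_tendstoD(1)[OF Qlim zero_less_one]
  proof eventually_elim
    case (elim t)
    have "(matrix_powr (\<rho> (Z t)) \<alpha> - ?P) ** K t = matrix_powr (\<rho> (Z t)) \<alpha> ** K t - ?P ** K t"
      by (simp add: matrix_matrix_mult_def vec_eq_iff algebra_simps sum_subtractf)
    then have "Re (trace (((1 / t) *\<^sub>R (matrix_powr (\<rho> (Z t)) \<alpha> - ?P)) ** K t)) = - Re (trace (?P ** K t)) / t"
      by (simp add: scaleR_matrix_mult_left trace_scaleR trace_sub trK)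
    moreover have "1 / b * ((- r / t) / q) = (1 / (- b) * (r / q)) / t" for b r q :: real
      by (simp add: mult_ac)
    from this[of "1 - \<alpha>" "Re (trace (?P ** K t))" "Q t"]
    have "1 / (1 - \<alpha>) * ((- Re (trace (?P ** K t)) / t) / Q t) = (h t - h 0) / t"
      using h[OF elim] by (simp add: h0)
    ultimately show ?case by simp
  qed
  ultimately have "((\<lambda>t. (h t - h 0) / t) \<longlongrightarrow> 1 / (1 - \<alpha>) * (T / 1)) (at 0)"
    by (rule Lim_transform_eventually)
  then have "(h has_real_derivative 1 / (1 - \<alpha>) * T) (at 0)"
    by (simp add: DERIV_def)
  then have "deriv h 0 = 1 / (1 - \<alpha>) * T" by (rule DERIV_imp_deriv)
  then show ?thesis
    by (simp add: petz_renyi_hessian_def partial_deriv_def[of i] T_def K_def Z0 flip: h_def)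
qed

end

subsection \<open>Monotonicity\<close>

text \<open>Here \<open>p\<close> will be a pair of eigenvector indices and \<open>N i p\<close> an
  entry of the \<open>i\<close>-th partial derivative in the eigenbasis. The inner product is that
  of \<open>complex\<close> as a real plane, which makes the matrix real and symmetric.\<close>

definition weighted_gram :: "('p::finite \<Rightarrow> real) \<Rightarrow> ('l \<Rightarrow> 'p \<Rightarrow> complex) \<Rightarrow> real^'l^'l" where
  "weighted_gram w N = (\<chi> i j. \<Sum>p\<in>UNIV. w p * (N i p \<bullet> N j p))"

lemma weighted_gram_diff: "weighted_gram v N - weighted_gram w N = weighted_gram (\<lambda>p. v p - w p) N"
  by (simp add: weighted_gram_def vec_eq_iff algebra_simps sum_subtractf)

lemma inner_weighted_gram:
  "x \<bullet> (weighted_gram w N *v x) = (\<Sum>p\<in>UNIV. w p * (norm (\<Sum>i\<in>UNIV. x $ i *\<^sub>R N i p))\<^sup>2)"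
proof -
  let ?f = "\<lambda>i j p. w p * (x $ i * (x $ j * (N i p \<bullet> N j p)))"
  have "x \<bullet> (weighted_gram w N *v x) = (\<Sum>i\<in>UNIV. \<Sum>j\<in>UNIV. \<Sum>p\<in>UNIV. ?f i j p)"
    by (simp add: inner_vec_def matrix_vector_mult_def weighted_gram_def sum_distrib_left sum_distrib_right mult_ac)
  also have "\<dots> = (\<Sum>i\<in>UNIV. \<Sum>p\<in>UNIV. \<Sum>j\<in>UNIV. ?f i j p)"
    by (intro sum.cong refl sum.swap)
  also have "\<dots> = (\<Sum>p\<in>UNIV. \<Sum>i\<in>UNIV. \<Sum>j\<in>UNIV. ?f i j p)"
    by (rule sum.swap)
  also have "\<dots> = (\<Sum>p\<in>UNIV. w p * (norm (\<Sum>i\<in>UNIV. x $ i *\<^sub>R N i p))\<^sup>2)"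
    by (simp add: power2_norm_eq_inner inner_sum_left inner_sum_right sum_distrib_left inner_commute mult.left_commute)
  finally show ?thesis .
qed

text \<open>The quadratic form of a weighted Gram matrix is a sum of squared norms times the
  weights, so the Loewner order reduces to a comparison of weights.\<close>

lemma loewner_le_weighted_gram:
  assumes "\<And>p. v p \<le> w p"
  shows "loewner_le (weighted_gram v N) (weighted_gram w N)"
proof -
  have "transpose (weighted_gram u N) = weighted_gram u N" for u
    by (simp add: transpose_def weighted_gram_def vec_eq_iff inner_commute)
  then show ?thesis
    using assms unfolding loewner_le_def real_pos_semidef_def weighted_gram_diff inner_weighted_gram
    by (simp add: sum_nonneg)
qed

lemma tendsto_weighted_gram:
  assumes "\<And>p. ((\<lambda>x. w x p) \<longlongrightarrow> v p) F"
  shows "((\<lambda>x. weighted_gram (w x) N) \<longlongrightarrow> weighted_gram v N) F"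
  unfolding weighted_gram_def by (intro vec_tendstoI) (simp, intro tendsto_intros assms)

text \<open>Treats \<open>\<alpha> = 1\<close> by a limit exactly as
  \<open>petz_renyi_information\<close> does.\<close>

definition petz_kernel_ext :: "real \<Rightarrow> real \<Rightarrow> real \<Rightarrow> real" where
  "petz_kernel_ext \<alpha> x y = (if \<alpha> = 1 then Lim (at 1) (\<lambda>\<beta>. petz_kernel \<beta> x y) else petz_kernel \<alpha> x y)"

lemma tendsto_petz_kernel_ext:
  assumes "x > 0" "y > 0"
  shows "((\<lambda>\<alpha>. petz_kernel \<alpha> x y) \<longlongrightarrow> petz_kernel_ext 1 x y) (at 1)"
  using petz_kernel_convergent[OF assms] tendsto_Lim[of "at (1::real)"] by (auto simp: petz_kernel_ext_def)

text \<open>Only comparisons with the value at \<open>1\<close> are new; they are one-sided limits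
  of the inequalities on the corresponding side of \<open>1\<close>.\<close>

lemma petz_kernel_ext_mono:
  assumes "x > 0" "y > 0" "1/2 \<le> \<alpha>" "\<alpha> \<le> \<beta>"
  shows "petz_kernel_ext \<alpha> x y \<le> petz_kernel_ext \<beta> x y"
proof -
  note lim = tendsto_petz_kernel_ext[OF assms(1,2)]
  consider "\<alpha> = \<beta>" | "\<alpha> \<noteq> 1" "\<beta> \<noteq> 1" | "\<alpha> < 1" "\<beta> = 1" | "\<alpha> = 1" "1 < \<beta>"
    using assms(4) by linarith
  then show ?thesis
  proof cases
    case 2
    then show ?thesis using petz_kernel_mono assms by (simp add: petz_kernel_ext_def)
  next
    case 3
    have "eventually (\<lambda>\<gamma>. \<gamma> \<in> {\<alpha><..<1}) (at_left 1)"
      using 3 by (intro eventually_at_leftI) auto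
    then have "eventually (\<lambda>\<gamma>. petz_kernel \<alpha> x y \<le> petz_kernel \<gamma> x y) (at_left 1)"
      by eventually_elim (use assms 3 in \<open>auto intro!: petz_kernel_mono\<close>)
    moreover have "((\<lambda>\<gamma>. petz_kernel \<gamma> x y) \<longlongrightarrow> petz_kernel_ext 1 x y) (at_left 1)"
      using lim by (rule tendsto_within_subset) simp
    ultimately have "petz_kernel \<alpha> x y \<le> petz_kernel_ext 1 x y"
      by (intro tendsto_lowerbound) auto
    then show ?thesis using 3 by (simp add: petz_kernel_ext_def)
  next
    case 4
    have "eventually (\<lambda>\<gamma>. \<gamma> \<in> {1<..<\<beta>}) (at_right 1)"
      using 4 by (intro eventually_at_rightI) auto
    then have "eventually (\<lambda>\<gamma>. petz_kernel \<gamma> x y \<le> petz_kernel \<beta> x y) (at_right 1)"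
      by eventually_elim (use assms 4 in \<open>auto intro!: petz_kernel_mono\<close>)
    moreover have "((\<lambda>\<gamma>. petz_kernel \<gamma> x y) \<longlongrightarrow> petz_kernel_ext 1 x y) (at_right 1)"
      using lim by (rule tendsto_within_subset) simp
    ultimately have "petz_kernel_ext 1 x y \<le> petz_kernel \<beta> x y"
      by (intro tendsto_upperbound) auto
    then show ?thesis using 4 by (simp add: petz_kernel_ext_def)
  qed simp
qed

text \<open>The reflection \<open>\<alpha> \<mapsto> 1 - \<alpha>\<close> preserves the kernel and
  maps this interval into \<open>[1/2, 1)\<close>, reversing the order.\<close>

lemma petz_kernel_ext_antimono:
  assumes "x > 0" "y > 0" "\<alpha> \<in> {0<..1/2}" "\<beta> \<in> {0<..1/2}" "\<alpha> \<le> \<beta>"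
  shows "petz_kernel_ext \<beta> x y \<le> petz_kernel_ext \<alpha> x y"
  using petz_kernel_mono[of x y "1 - \<beta>" "1 - \<alpha>"] assms
  by (simp add: petz_kernel_ext_def petz_kernel_flip)

context state_family
begin

text \<open>The point is that \<open>d\<close> and \<open>N\<close> do not depend on
  \<open>\<alpha>\<close>, which enters through the weights alone.\<close>

lemma petz_renyi_information_gram:
  obtains N :: "'l \<Rightarrow> 'n \<times> 'n \<Rightarrow> complex" and d :: "'n \<Rightarrow> real"
  where "\<And>a. d a > 0" "\<And>\<alpha>. petz_renyi_information \<rho> \<theta> \<alpha> =
    weighted_gram (\<lambda>(a, b). petz_kernel_ext \<alpha> (d a) (d b)) N"
proof -
  obtain U d where U: "unitary_matrix U" "\<rho> \<theta> = U ** real_diag d ** adjoint_matrix U"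
    and d: "\<And>i. 0 < d i" "\<And>i. d i \<le> 1" using pos_def_state_spectral[OF state pos_def] by metis
  define A where "A i = adjoint_matrix U ** \<rho>' \<theta> (axis i 1) ** U" for i
  define N where "N i p = A i $ fst p $ snd p" for i p
  have adj: "adjoint_matrix (A i) = A i" for i
    by (simp add: A_def adjoint_matrix_mult hermitian_deriv matrix_mul_assoc)
  have Aba: "A i $ b $ a = cnj (A i $ a $ b)" for i a b
    by (subst adj[symmetric]) (simp add: adjoint_matrix_def)
  \<comment> \<open>Hermiticity of the derivative turns the product of the \<open>(a, b)\<close> and
    \<open>(b, a)\<close> entries from the trace into an inner product of two \<open>(a, b)\<close>
    entries.\<close>
  have Re_mult: "Re (of_real r * (A i $ a $ b * A j $ b $ a)) = r * (A i $ a $ b \<bullet> A j $ a $ b)" for r i j a b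
    by (subst Aba[of j]) (simp add: inner_complex_def)
  have hess: "petz_renyi_hessian \<rho> \<theta> \<alpha> = weighted_gram (\<lambda>(a, b). petz_kernel \<alpha> (d a) (d b)) N" if "\<alpha> \<noteq> 1" for \<alpha>
  proof -
    have "petz_renyi_hessian \<rho> \<theta> \<alpha> $ i $ j = weighted_gram (\<lambda>(a, b). petz_kernel \<alpha> (d a) (d b)) N $ i $ j" for i j
    proof -
      have "petz_renyi_hessian \<rho> \<theta> \<alpha> $ i $ j = (\<Sum>a\<in>UNIV. \<Sum>b\<in>UNIV. petz_kernel \<alpha> (d a) (d b) * (A i $ a $ b \<bullet> A j $ a $ b))"
        unfolding petz_renyi_hessian_entry[OF that] trace_quot_mult_quot[OF U d] A_def[symmetric]
        by (simp add: Re_mult sum_distrib_left petz_kernel_def del: times_complex.sel of_real_mult)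
      also have "\<dots> = (\<Sum>p\<in>UNIV. case p of (a, b) \<Rightarrow> petz_kernel \<alpha> (d a) (d b) * (A i $ a $ b \<bullet> A j $ a $ b))"
        by (simp add: sum.cartesian_product)
      also have "\<dots> = weighted_gram (\<lambda>(a, b). petz_kernel \<alpha> (d a) (d b)) N $ i $ j"
        by (simp add: weighted_gram_def N_def case_prod_beta)
      finally show ?thesis .
    qed
    then show ?thesis by (simp add: vec_eq_iff)
  qed
  have "petz_renyi_information \<rho> \<theta> \<alpha> = weighted_gram (\<lambda>(a, b). petz_kernel_ext \<alpha> (d a) (d b)) N" for \<alpha>
  proof (cases "\<alpha> = 1")
    case True
    \<comment> \<open>Convergence of the weights gives convergence of the matrices, which determines
      the value of \<open>Lim\<close> in the definition at \<open>\<alpha> = 1\<close>.\<close>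
    have "((\<lambda>\<beta>. weighted_gram (\<lambda>(a, b). petz_kernel \<beta> (d a) (d b)) N) \<longlongrightarrow>
        weighted_gram (\<lambda>(a, b). petz_kernel_ext 1 (d a) (d b)) N) (at 1)"
      using d(1) by (intro tendsto_weighted_gram) (auto intro: tendsto_petz_kernel_ext)
    moreover have "eventually (\<lambda>\<beta>::real. \<beta> \<noteq> 1) (at 1)" by (rule eventually_neq_at_within)
    then have "eventually (\<lambda>\<beta>. weighted_gram (\<lambda>(a, b). petz_kernel \<beta> (d a) (d b)) N = petz_renyi_hessian \<rho> \<theta> \<beta>) (at 1)"
      by eventually_elim (simp add: hess)
    ultimately have "(petz_renyi_hessian \<rho> \<theta> \<longlongrightarrow> weighted_gram (\<lambda>(a, b). petz_kernel_ext 1 (d a) (d b)) N) (at 1)"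
      by (rule Lim_transform_eventually)
    then show ?thesis
      using True tendsto_Lim[of "at (1::real)"] by (simp add: petz_renyi_information_def)
  next
    case False
    then show ?thesis by (simp add: petz_renyi_information_def hess petz_kernel_ext_def)
  qed
  with d(1) show ?thesis using that by blast
qed

end

theorem theorem28:
  fixes \<rho> :: "real^'l \<Rightarrow> complex^'n^'n" and \<theta> :: "real^'l"
  assumes "\<And>x. state (\<rho> x)" and "\<And>x. pos_def (\<rho> x)"
    and "twice_differentiable \<rho>"
  shows "monotone_on {0<..1/2} (\<le>) (\<lambda>A B. loewner_le B A) (petz_renyi_information \<rho> \<theta>)
       \<and> monotone_on {1/2..} (\<le>) loewner_le (petz_renyi_information \<rho> \<theta>)"
proof -
  obtain \<rho>' where "state_family \<rho> \<rho>'"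
    using assms by (auto simp: twice_differentiable_def state_family_def)
  then obtain N and d :: "'n \<Rightarrow> real" where d: "\<And>a. d a > 0"
    and I: "\<And>\<alpha>. petz_renyi_information \<rho> \<theta> \<alpha> = weighted_gram (\<lambda>(a, b). petz_kernel_ext \<alpha> (d a) (d b)) N"
    using state_family.petz_renyi_information_gram by metis
  show ?thesis
    unfolding monotone_on_def I
  proof (intro conjI ballI impI loewner_le_weighted_gram)
    show "(case p of (a, b) \<Rightarrow> petz_kernel_ext \<beta> (d a) (d b)) \<le> (case p of (a, b) \<Rightarrow> petz_kernel_ext \<alpha> (d a) (d b))"
      if "\<alpha> \<in> {0<..1/2}" "\<beta> \<in> {0<..1/2}" "\<alpha> \<le> \<beta>" for p \<alpha> \<beta>
      using petz_kernel_ext_antimono[OF d d that] by (simp add: case_prod_beta)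
    show "(case p of (a, b) \<Rightarrow> petz_kernel_ext \<alpha> (d a) (d b)) \<le> (case p of (a, b) \<Rightarrow> petz_kernel_ext \<beta> (d a) (d b))"
      if "\<alpha> \<in> {1/2..}" "\<beta> \<in> {1/2..}" "\<alpha> \<le> \<beta>" for p \<alpha> \<beta>
      using petz_kernel_ext_mono[OF d d _ that(3)] that(1) by (simp add: case_prod_beta)
  qed
qed

end
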